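(* Let $\lambda>0$ and $\alpha>0$. Let $\{c_k\}_{k\ge1}$ be i.i.d. random variables whose common distribution is absolutely continuous on $[0,1]$ with density that is bounded and positive almost everywhere with respect to Lebesgue measure. Let $l_k=e^{-\lambda k^\alpha}$, let $I_k$ be the open interval of length $l_k$ centered at $c_k$, and let $S=\bigcap_{m\ge1}\bigcup_{k\ge m} I_k$. Then: (1) if $0<\alpha\le 1$, then almost surely $\mathrm{Cap}(S)=\mathrm{Cap}([0,1])>0$; (2) if $\alpha>1$, then $\mathrm{Cap}(S)=0$.
   Context: For finite Borel measures $\mu,\nu$ on $\mathbb{C}$, the interaction is $I(\nu,\mu)=\iint(-\log|z-w|)\,d\nu(z)\,d\mu(w)$ and the energy is $I(\mu)=I(\mu,\mu)$. The logarithmic capacity of $E\subset\mathbb{C}$ is $\mathrm{Cap}(E)=\exp(-\inf I(\mu))$, the infimum over Borel probability measures $\mu$ whose support is a compact subset of $E$ (with $e^{-\infty}=0$). *)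

theory Defs
  imports "HOL-Probability.Probability"
begin

definition log_kernel_pos :: "complex \<Rightarrow> complex \<Rightarrow> ennreal" where
  "log_kernel_pos z w = (if z = w then \<infinity> else ennreal (max 0 (- ln (cmod (z - w)))))"

definition log_kernel_neg :: "complex \<Rightarrow> complex \<Rightarrow> ennreal" where
  "log_kernel_neg z w = (if z = w then 0 else ennreal (max 0 (ln (cmod (z - w)))))"

text \<open>Logarithmic energy I(mu) = double integral of -log|z-w| d mu d mu.
  For compactly supported finite measures the negative part is finite,
  so this is a well-defined element of (-\<infinity>, \<infinity>].\<close>
definition log_energy :: "complex measure \<Rightarrow> ereal" where
  "log_energy \<mu> =
     enn2ereal (\<integral>\<^sup>+ z. (\<integral>\<^sup>+ w. log_kernel_pos z w \<partial>\<mu>) \<partial>\<mu>)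
   - enn2ereal (\<integral>\<^sup>+ z. (\<integral>\<^sup>+ w. log_kernel_neg z w \<partial>\<mu>) \<partial>\<mu>)"

definition measure_support :: "complex measure \<Rightarrow> complex set" where
  "measure_support \<mu> = {z. \<forall>e>0. emeasure \<mu> (ball z e) > 0}"

definition cap_measures :: "complex set \<Rightarrow> complex measure set" where
  "cap_measures E = {\<mu>. sets \<mu> = sets borel \<and> prob_space \<mu> \<and>
        compact (measure_support \<mu>) \<and> measure_support \<mu> \<subseteq> E}"

definition log_capacity :: "complex set \<Rightarrow> ereal" where
  "log_capacity E =
     (case (INF \<mu>\<in>cap_measures E. log_energy \<mu>) of
        ereal r \<Rightarrow> ereal (exp (- r))
      | PInfty \<Rightarrow> 0
      | MInfty \<Rightarrow> \<infinity>)"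

definition limsup_set :: "real \<Rightarrow> real \<Rightarrow> (nat \<Rightarrow> real) \<Rightarrow> real set" where
  "limsup_set lam \<alpha> c =
     (\<Inter>m\<in>{1..}. \<Union>k\<in>{m..}.
        {c k - exp (- lam * real k powr \<alpha>) / 2 <..< c k + exp (- lam * real k powr \<alpha>) / 2})"

end

theory Submission
  imports Defs "HOL-Real_Asymp.Real_Asymp"
begin

text \<open>
  For \<open>\<alpha> > 1\<close>, disjoint pieces \<open>J k \<subseteq> I k\<close> covering \<open>S\<close> give \<open>(\<Sum>k\<ge>m. N (J k)\<^sup>2 * (lam * k powr \<alpha>)) \<le> I(N)\<close>
  for every probability measure \<open>N\<close> on \<open>S\<close>, so by Cauchy--Schwarz finite energy would force
  \<open>1 \<le> I(N) * (\<Sum>k\<ge>m. 1 / (lam * k powr \<alpha>))\<close>, whose right-hand side tends to \<open>0\<close>.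

  For \<open>\<alpha> \<le> 1\<close>, approximate the law \<open>g\<close> to be realised by \<open>h * f\<close> with \<open>h\<close> bounded, and put on a block of
  indices the random measure that gives the centred interval around \<open>c k\<close> the mass
  \<open>k powr (- \<alpha>) * h (c k)\<close>. The diagonal part of its energy has order \<open>L = (\<Sum>k. k powr (- \<alpha>))\<close>, the rest
  has mean about \<open>L\<^sup>2 * I(h * f)\<close>, and the squared mass has mean at least \<open>L\<^sup>2 * (\<integral> h * f)\<^sup>2\<close>. Since the mass is
  at most of order \<open>L\<close>, the normalised energy is nearly minimal with a probability bounded below
  uniformly over the blocks, hence almost surely for some block. Applied to a countable base of open
  sets this shows that intersecting with a union of late intervals leaves the energy minimum of each
  open set unchanged; a nested choice of compact sets, Helly selection and lower semicontinuity of
  the energy then give the claim for the countable intersection.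
\<close>

section \<open>Kernel and smeared kernel\<close>

text \<open>Since \<open>ennreal\<close> truncates negative reals to 0, this is the positive part of
  the kernel. Points of [0,1] have distance at most 1, so there it is the whole kernel and energies
  can be computed in [0, \<infinity>].\<close>

definition log_ker :: "real \<Rightarrow> real \<Rightarrow> ennreal" where
  "log_ker x y = log_kernel_pos (complex_of_real x) (complex_of_real y)"

text \<open>\<open>b\<close> may be negative: it is then truncated to 0, and
  \<open>a \<le> c\<close> still follows.\<close>

lemma ennreal_le_plus: "a \<le> b + c \<Longrightarrow> 0 \<le> c \<Longrightarrow> ennreal a \<le> ennreal b + ennreal c"
proof (cases "0 \<le> b")
  case True
  then show "a \<le> b + c \<Longrightarrow> 0 \<le> c \<Longrightarrow> ?thesis" by (simp add: ennreal_leI flip: ennreal_plus)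
next
  case False
  then show "a \<le> b + c \<Longrightarrow> 0 \<le> c \<Longrightarrow> ?thesis" by (simp add: ennreal_leI ennreal_neg)
qed

lemma log_ker_altdef: "log_ker x y = (if x = y then \<infinity> else ennreal (- ln \<bar>x - y\<bar>))"
proof -
  have "cmod (complex_of_real x - complex_of_real y) = \<bar>x - y\<bar>"
    by (metis norm_of_real of_real_diff)
  then show ?thesis by (simp add: log_ker_def log_kernel_pos_def)
qed

lemma log_ker_refl [simp]: "log_ker x x = \<infinity>"
  by (simp add: log_ker_altdef)

lemma log_ker_commute: "log_ker x y = log_ker y x"
  by (simp add: log_ker_altdef abs_minus_commute)

lemma measurable_log_ker [measurable (raw)]:
  assumes [measurable]: "g \<in> borel_measurable M" "h \<in> borel_measurable M"
  shows "(\<lambda>p. log_ker (g p) (h p)) \<in> borel_measurable M"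
  unfolding log_ker_altdef by measurable

definition energy :: "real measure \<Rightarrow> ennreal" where
  "energy N = (\<integral>\<^sup>+ x. (\<integral>\<^sup>+ y. log_ker x y \<partial>N) \<partial>N)"

text \<open>An atom at \<open>x\<close> charges the diagonal point \<open>(x, x)\<close>, where the
  kernel is infinite.\<close>

lemma energy_finite_imp_no_atoms:
  assumes [measurable_cong]: "sets N = sets borel" and "energy N < \<infinity>"
  shows "emeasure N {x} = 0"
proof (rule ccontr)
  assume pos: "emeasure N {x} \<noteq> 0"
  have ind: "(\<integral>\<^sup>+ v. \<infinity> * indicator {x} v \<partial>N) = \<infinity>"
    using pos by (subst nn_integral_cmult_indicator) (auto simp: assms(1) ennreal_top_mult)
  have "(\<integral>\<^sup>+ v. \<infinity> * indicator {x} v \<partial>N) \<le> (\<integral>\<^sup>+ v. log_ker x v \<partial>N)"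
    by (intro nn_integral_mono) (auto split: split_indicator)
  then have top: "(\<integral>\<^sup>+ v. log_ker x v \<partial>N) = \<infinity>"
    using ind by (simp add: top_unique)
  have "\<infinity> = (\<integral>\<^sup>+ u. \<infinity> * indicator {x} u \<partial>N)"
    by (rule ind[symmetric])
  also have "\<dots> \<le> energy N"
    unfolding energy_def using top
    by (intro nn_integral_mono) (auto split: split_indicator)
  finally show False using assms(2) by simp
qed

section \<open>Uniform distributions on intervals and their mutual energy\<close>

definition bump :: "real \<Rightarrow> real \<Rightarrow> real \<Rightarrow> ennreal" where
  "bump r x u = (if \<bar>u - x\<bar> \<le> r then ennreal (1 / (2 * r)) else 0)"

lemma measurable_bump [measurable (raw)]:
  assumes [measurable]: "g \<in> borel_measurable M" "h \<in> borel_measurable M"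
  shows "(\<lambda>p. bump r (g p) (h p)) \<in> borel_measurable M"
  unfolding bump_def by measurable

lemma bump_altdef: "bump r x u = ennreal (1 / (2 * r)) * indicator {x - r..x + r} u"
  by (auto simp: bump_def split: split_indicator)

lemma nn_integral_bump: "r > 0 \<Longrightarrow> (\<integral>\<^sup>+ u. bump r x u \<partial>lborel) = 1"
  unfolding bump_altdef
  by (subst nn_integral_cmult_indicator) (auto simp flip: ennreal_mult)

text \<open>The mutual energy of the uniform distributions with radii \<open>r\<close> and
  \<open>s\<close> around \<open>x\<close> and \<open>y\<close>. For radii in (0,1] it is finite
  even when \<open>x = y\<close>, which is why intervals can replace points.\<close>

definition smear :: "real \<Rightarrow> real \<Rightarrow> real \<Rightarrow> real \<Rightarrow> ennreal" where
  "smear r s x y = (\<integral>\<^sup>+ u. (\<integral>\<^sup>+ v. bump r x u * (bump s y v * log_ker u v) \<partial>lborel) \<partial>lborel)"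

lemma measurable_smear [measurable (raw)]:
  assumes [measurable]: "g \<in> borel_measurable M" "h \<in> borel_measurable M"
  shows "(\<lambda>p. smear r s (g p) (h p)) \<in> borel_measurable M"
  unfolding smear_def by measurable

lemma smear_commute: "smear r s x y = smear s r y x"
  unfolding smear_def
  by (subst lborel_pair.Fubini') (auto simp: log_ker_commute mult_ac)

text \<open>Layer-cake: \<open>ln (r / \<bar>u - v\<bar>)\<close> is the length of \<open>{t \<ge> 0. \<bar>u - v\<bar> \<le> r * exp (- t)}\<close>.\<close>
lemma nn_integral_ln_le:
  fixes r v :: real assumes r: "r > 0"
  shows "(\<integral>\<^sup>+ u. (if u = v then \<infinity> else ennreal (max 0 (ln (r / \<bar>u - v\<bar>)))) \<partial>lborel) \<le> ennreal (2 * r)"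
proof -
  let ?S = "{p::real \<times> real. 0 \<le> snd p \<and> \<bar>fst p - v\<bar> \<le> r * exp (- snd p)}"
  have "{p \<in> space (borel \<Otimes>\<^sub>M borel). 0 \<le> snd p \<and> \<bar>fst p - v\<bar> \<le> r * exp (- snd p)} \<in> sets (borel \<Otimes>\<^sub>M borel)"
    by measurable
  then have S: "?S \<in> sets (lborel \<Otimes>\<^sub>M lborel)"
    by (simp add: space_pair_measure cong: sets_pair_measure_cong)
  then have m: "(\<lambda>(u, t). indicator ?S (u, t) :: ennreal) \<in> borel_measurable (lborel \<Otimes>\<^sub>M lborel)"
    by (subst case_prod_eta) (rule borel_measurable_indicator)
  have layer: "(if u = v then \<infinity> else ennreal (max 0 (ln (r / \<bar>u - v\<bar>)))) = 
      (\<integral>\<^sup>+ t. indicator ?S (u, t) \<partial>lborel)" if "u \<noteq> v" for u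
  proof -
    have eq: "{t. (u, t) \<in> ?S} = {0..ln (r / \<bar>u - v\<bar>)}"
    proof -
      have "\<bar>u - v\<bar> \<le> r * exp (- t) \<longleftrightarrow> t \<le> ln (r / \<bar>u - v\<bar>)" for t
      proof -
        have "\<bar>u - v\<bar> \<le> r * exp (- t) \<longleftrightarrow> \<bar>u - v\<bar> \<le> r / exp t"
          by (simp only: exp_minus divide_inverse)
        also have "\<dots> \<longleftrightarrow> exp t \<le> r / \<bar>u - v\<bar>"
          using that by (simp only: pos_le_divide_eq exp_gt_zero zero_less_abs_iff right_minus_eq mult.commute not_False_eq_True)
        also have "\<dots> \<longleftrightarrow> t \<le> ln (r / \<bar>u - v\<bar>)"
          using that r by (subst ln_ge_iff) simp_all
        finally show ?thesis .
      qed
      then show ?thesis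
        by (simp only: set_eq_iff mem_Collect_eq fst_conv snd_conv atLeastAtMost_iff simp_thms)
    qed
    have "(\<integral>\<^sup>+ t. indicator ?S (u, t) \<partial>lborel) = (\<integral>\<^sup>+ t. indicator {t. (u, t) \<in> ?S} t \<partial>lborel)"
      by (intro nn_integral_cong) (auto split: split_indicator)
    also have "\<dots> = ennreal (max 0 (ln (r / \<bar>u - v\<bar>)))"
      unfolding eq by (auto simp: max_def emeasure_lborel_Icc_eq)
    finally show ?thesis using that by simp
  qed
  have "(\<integral>\<^sup>+ u. (if u = v then \<infinity> else ennreal (max 0 (ln (r / \<bar>u - v\<bar>)))) \<partial>lborel) =
     (\<integral>\<^sup>+ u. (\<integral>\<^sup>+ t. indicator ?S (u, t) \<partial>lborel) \<partial>lborel)"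
    by (rule nn_integral_cong_AE, rule AE_mp[OF AE_lborel_singleton[of v]], rule AE_I2, rule impI, erule layer)
  also have "\<dots> = (\<integral>\<^sup>+ t. (\<integral>\<^sup>+ u. indicator ?S (u, t) \<partial>lborel) \<partial>lborel)"
    by (rule lborel_pair.Fubini'[symmetric, OF m])
  \<comment> \<open>The slice at height \<open>t\<close> is an interval of length
    \<open>2 * r * exp (- t)\<close>, that is \<open>2 * r\<close> times the standard exponential
    density.\<close>
  also have "\<dots> = (\<integral>\<^sup>+ t. ennreal (2 * r) * ennreal (exponential_density 1 t) \<partial>lborel)"
  proof (rule nn_integral_cong)
    fix t :: real
    show "(\<integral>\<^sup>+ u. indicator ?S (u, t) \<partial>lborel) = ennreal (2 * r) * ennreal (exponential_density 1 t)"
    proof (cases "t \<ge> 0")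
      case True
      have "(\<integral>\<^sup>+ u. indicator ?S (u, t) \<partial>lborel) = (\<integral>\<^sup>+ u. indicator {v - r * exp (- t)..v + r * exp (- t)} u \<partial>lborel)"
        using True by (intro nn_integral_cong) (auto split: split_indicator)
      also have "\<dots> = ennreal (2 * r * exp (- t))"
        using r by simp
      finally show ?thesis using True r by (simp add: exponential_density_def flip: ennreal_mult)
    next
      case False then show ?thesis by (simp add: exponential_density_def)
    qed
  qed
  also have "\<dots> = ennreal (2 * r) * (\<integral>\<^sup>+ t. ennreal (exponential_density 1 t) \<partial>lborel)"
    by (rule nn_integral_cmult) simp
  also have "(\<integral>\<^sup>+ t. ennreal (exponential_density 1 t) \<partial>lborel) = 1"
    using prob_space.emeasure_space_1[OF prob_space_exponential_density[of 1]]
    by (simp add: emeasure_density)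
  finally show ?thesis by simp
qed

text \<open>Split \<open>- ln \<bar>u - v\<bar>\<close> as
  \<open>- ln r + ln (r / \<bar>u - v\<bar>)\<close>. The first term is constant; the positive part
  of the second has integral at most \<open>2 * r\<close> and meets a density of height
  \<open>1 / (2 * r)\<close>, so it contributes at most 1.\<close>

lemma nn_integral_bump_log_ker_le:
  assumes "0 < r" "r \<le> 1"
  shows "(\<integral>\<^sup>+ u. bump r x u * log_ker u v \<partial>lborel) \<le> ennreal (1 - ln r)"
proof -
  define q where "q u = (if u = v then \<infinity> else ennreal (max 0 (ln (r / \<bar>u - v\<bar>))))" for u :: real
  have [measurable]: "q \<in> borel_measurable borel" unfolding q_def by measurable
  have le: "log_ker u v \<le> ennreal (- ln r) + q u" for u
  proof (cases "u = v")
    case False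
    have "- ln \<bar>u - v\<bar> \<le> - ln r + max 0 (ln (r / \<bar>u - v\<bar>))"
      using assms False by (simp add: ln_div)
    then have "ennreal (- ln \<bar>u - v\<bar>) \<le> ennreal (- ln r) + ennreal (max 0 (ln (r / \<bar>u - v\<bar>)))"
      by (rule ennreal_le_plus) simp
    then show ?thesis using False by (simp add: log_ker_altdef q_def)
  qed (simp add: q_def)
  have "(\<integral>\<^sup>+ u. bump r x u * log_ker u v \<partial>lborel) \<le> (\<integral>\<^sup>+ u. bump r x u * ennreal (- ln r) + ennreal (1 / (2 * r)) * q u \<partial>lborel)"
  proof (rule nn_integral_mono)
    fix u
    have "bump r x u * log_ker u v \<le> bump r x u * (ennreal (- ln r) + q u)" 
      by (intro mult_left_mono le) simp
    also have "\<dots> \<le> bump r x u * ennreal (- ln r) + ennreal (1 / (2 * r)) * q u"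
      unfolding distrib_left
      by (intro add_left_mono mult_right_mono) (auto simp: bump_def)
    finally show "bump r x u * log_ker u v \<le> bump r x u * ennreal (- ln r) + ennreal (1 / (2 * r)) * q u" .
  qed
  also have "\<dots> = (\<integral>\<^sup>+ u. bump r x u \<partial>lborel) * ennreal (- ln r) + ennreal (1 / (2 * r)) * (\<integral>\<^sup>+ u. q u \<partial>lborel)"
    by (subst nn_integral_add) (auto simp: nn_integral_cmult nn_integral_multc)
  also have "\<dots> \<le> ennreal (- ln r) + ennreal (1 / (2 * r)) * ennreal (2 * r)"
    unfolding q_def using nn_integral_ln_le[OF assms(1), of v]
    by (intro add_mono mult_left_mono) (auto simp: nn_integral_bump assms)
  also have "\<dots> = ennreal (1 - ln r)"
  proof -
    have "ennreal (1 / (2 * r)) * ennreal (2 * r) = ennreal 1"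
      using assms by (subst ennreal_mult[symmetric]) auto
    then show ?thesis using assms by (simp only: ennreal_plus[symmetric, of "- ln r" 1] ln_le_zero_iff neg_0_le_iff_le zero_le_one) simp
  qed
  finally show ?thesis .
qed

lemma smear_le_ln:
  assumes "0 < r" "r \<le> 1" "0 < s"
  shows "smear r s x y \<le> ennreal (1 - ln r)"
proof -
  have "smear r s x y = (\<integral>\<^sup>+ v. bump s y v * (\<integral>\<^sup>+ u. bump r x u * log_ker u v \<partial>lborel) \<partial>lborel)"
    unfolding smear_def
    by (subst lborel_pair.Fubini') (auto simp: mult_ac simp flip: nn_integral_cmult)
  also have "\<dots> \<le> (\<integral>\<^sup>+ v. bump s y v * ennreal (1 - ln r) \<partial>lborel)"
    by (intro nn_integral_mono mult_left_mono nn_integral_bump_log_ker_le assms) auto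
  also have "\<dots> = ennreal (1 - ln r)"
    using assms by (simp add: nn_integral_multc nn_integral_bump)
  finally show ?thesis .
qed

text \<open>By symmetry of \<open>smear\<close> the preceding bound holds with either radius, and
  the larger one gives the smaller bound.\<close>

lemma smear_le_max:
  assumes "0 < r" "r \<le> 1" "0 < s" "s \<le> 1"
  shows "smear r s x y \<le> ennreal (1 - ln (max r s))"
  using smear_le_ln[of r s x y] smear_le_ln[of s r y x] assms
  by (cases "r \<le> s") (simp_all add: smear_commute[of r s x y] max_def)

lemma smear_const:
  assumes "0 < r" "0 < s" "\<And>u v. \<bar>u - x\<bar> \<le> r \<Longrightarrow> \<bar>v - y\<bar> \<le> s \<Longrightarrow> log_ker u v \<le> C"
  shows "smear r s x y \<le> C"
proof -
  have "smear r s x y \<le> (\<integral>\<^sup>+ u. (\<integral>\<^sup>+ v. bump r x u * (bump s y v * C) \<partial>lborel) \<partial>lborel)"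
    unfolding smear_def using assms(3)
    by (intro nn_integral_mono) (auto simp: bump_def intro!: mult_left_mono)
  also have "\<dots> = C"
    using assms by (simp add: nn_integral_cmult nn_integral_multc nn_integral_bump)
  finally show ?thesis .
qed

text \<open>Moving both points by at most \<rho> shortens their distance by a factor of at least
  \<open>1 - 2 * \<rho> / \<bar>x - y\<bar>\<close>, which is at least 1/2 for such distant
  points.\<close>

lemma smear_far:
  assumes "0 < r" "r \<le> \<rho>" "0 < s" "s \<le> \<rho>" "4 * \<rho> \<le> \<bar>x - y\<bar>"
  shows "smear r s x y \<le> log_ker x y + ennreal (- ln (1 - 2 * \<rho> / \<bar>x - y\<bar>))"
proof (rule smear_const)
  fix u v assume uv: "\<bar>u - x\<bar> \<le> r" "\<bar>v - y\<bar> \<le> s"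
  define d where "d = \<bar>x - y\<bar>"
  have d: "d > 0" "4 * \<rho> \<le> d" using assms by (auto simp: d_def)
  have q: "0 < 1 - 2 * \<rho> / d" "1 - 2 * \<rho> / d \<le> 1" using d assms by (auto simp: field_simps)
  have "d * (1 - 2 * \<rho> / d) = d - 2 * \<rho>" using d by (simp add: field_simps)
  also have "\<dots> \<le> \<bar>u - v\<bar>" using uv assms by (auto simp: d_def)
  finally have ge: "d * (1 - 2 * \<rho> / d) \<le> \<bar>u - v\<bar>" .
  have p: "0 < d * (1 - 2 * \<rho> / d)" using d(1) q(1) by (rule mult_pos_pos)
  have "ln d + ln (1 - 2 * \<rho> / d) = ln (d * (1 - 2 * \<rho> / d))"
    using d q by (subst ln_mult) auto
  also have "\<dots> \<le> ln \<bar>u - v\<bar>" using ge p by (subst ln_le_cancel_iff) auto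
  finally have "ln d + ln (1 - 2 * \<rho> / d) \<le> ln \<bar>u - v\<bar>" .
  moreover have "ln (1 - 2 * \<rho> / d) \<le> 0" using q by simp
  ultimately have *: "ennreal (- ln \<bar>u - v\<bar>) \<le> ennreal (- ln d) + ennreal (- ln (1 - 2 * \<rho> / d))"
    by (intro ennreal_le_plus) auto
  have "0 < \<bar>u - v\<bar>" using ge p by linarith
  moreover have "x \<noteq> y" using d by (auto simp: d_def)
  ultimately show "log_ker u v \<le> log_ker x y + ennreal (- ln (1 - 2 * \<rho> / \<bar>x - y\<bar>))"
    using * unfolding log_ker_altdef d_def[symmetric] by auto
qed (use assms in auto)

text \<open>The additive price for replacing \<open>smear\<close> by \<open>log_ker\<close> when
  both radii are at most \<rho>. It is bounded and vanishes off the diagonal as \<rho> tends to 0.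
  The value 3 bounds \<open>1 + ln 4\<close>, which comes from close points.\<close>

definition smear_err :: "real \<Rightarrow> real \<Rightarrow> real \<Rightarrow> ennreal" where
  "smear_err \<rho> x y = ennreal (if 4 * \<rho> \<le> \<bar>x - y\<bar> then - ln (1 - 2 * \<rho> / \<bar>x - y\<bar>) else 3)"

lemma measurable_smear_err [measurable (raw)]:
  assumes [measurable]: "g \<in> borel_measurable M" "h \<in> borel_measurable M"
  shows "(\<lambda>p. smear_err r (g p) (h p)) \<in> borel_measurable M"
  unfolding smear_err_def by measurable

lemma ln_half_bound:
  assumes "0 < \<rho>" "4 * \<rho> \<le> (d::real)"
  shows "- ln (1 - 2 * \<rho> / d) \<le> 3"
proof -
  have "1 / 2 \<le> 1 - 2 * \<rho> / d" using assms by (auto simp: field_simps)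
  then have "ln (1 / 2) \<le> ln (1 - 2 * \<rho> / d)" by (subst ln_le_cancel_iff) auto
  moreover have "ln (1/2::real) = - ln 2" by (simp add: ln_div)
  moreover have "ln (2::real) \<le> 1" using ln_le_minus_one[of "2::real"] by simp
  ultimately show ?thesis by linarith
qed

lemma smear_err_le: "0 < \<rho> \<Longrightarrow> smear_err \<rho> x y \<le> ennreal 3"
  unfolding smear_err_def using ln_half_bound[of \<rho> "\<bar>x - y\<bar>"]
  by (cases "4 * \<rho> \<le> \<bar>x - y\<bar>") (simp_all add: ennreal_leI del: ennreal_numeral)

text \<open>The radii may be far smaller than \<rho>, so close points are compared with
  \<open>m = max r s\<close> instead. If their distance is at least \<open>4 * m\<close>, the far
  estimate loses at most \<open>ln 2\<close>; otherwise \<open>1 - ln m\<close> exceeds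
  \<open>- ln \<bar>x - y\<bar>\<close> by at most \<open>1 + ln 4\<close>.\<close>

lemma smear_le_err:
  assumes "0 < r" "r \<le> \<rho>" "0 < s" "s \<le> \<rho>" "\<rho> \<le> 1"
  shows "smear r s x y \<le> log_ker x y + smear_err \<rho> x y"
proof (cases "4 * \<rho> \<le> \<bar>x - y\<bar>")
  case True
  then show ?thesis using smear_far[of r \<rho> s x y] assms by (simp add: smear_err_def)
next
  case False
  define m where "m = max r s"
  have m: "0 < m" "m \<le> 1" "m \<le> \<rho>" "r \<le> m" "s \<le> m" using assms by (auto simp: m_def)
  show ?thesis
  proof (cases "4 * m \<le> \<bar>x - y\<bar>")
    case True
    have "smear r s x y \<le> log_ker x y + ennreal (- ln (1 - 2 * m / \<bar>x - y\<bar>))"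
      using smear_far[of r m s x y] True m assms by simp
    also have "\<dots> \<le> log_ker x y + ennreal 3"
      using True m by (intro add_left_mono ennreal_leI ln_half_bound) auto
    finally show ?thesis using False by (simp add: smear_err_def)
  next
    case nf: False
    show ?thesis
    proof (cases "x = y")
      case True then show ?thesis by simp
    next
      case xy: False
      have "ln \<bar>x - y\<bar> \<le> ln (4 * m)" using nf xy m by (subst ln_le_cancel_iff) auto
      also have "\<dots> = ln 4 + ln m" using m by (simp add: ln_mult)
      finally have le: "1 - ln m \<le> - ln \<bar>x - y\<bar> + (1 + ln 4)" by simp
      have "ln (4::real) = 2 * ln 2" using ln_realpow[of 2 2] by simp
      then have ln4: "ln (4::real) \<le> 2" using ln_le_minus_one[of "2::real"] by simp
      have "smear r s x y \<le> ennreal (1 - ln m)"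
        unfolding m_def using assms by (intro smear_le_max) auto
      also have "\<dots> \<le> ennreal (- ln \<bar>x - y\<bar>) + ennreal 3"
        using le ln4 by (intro ennreal_le_plus) auto
      also have "\<dots> = log_ker x y + ennreal 3"
        using xy by (simp add: log_ker_altdef)
      finally show ?thesis using False by (simp add: smear_err_def)
    qed
  qed
qed

lemma smear_err_tendsto_0:
  assumes "x \<noteq> y" "\<And>n. \<rho> n > 0" "\<rho> \<longlonglongrightarrow> 0"
  shows "(\<lambda>n. smear_err (\<rho> n) x y) \<longlonglongrightarrow> 0"
proof -
  have "((\<lambda>n. ennreal (- ln (1 - 2 * \<rho> n / \<bar>x - y\<bar>))) \<longlongrightarrow> ennreal (- ln (1 - 2 * 0 / \<bar>x - y\<bar>))) sequentially"
    using assms by (intro tendsto_intros) auto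
  then have *: "(\<lambda>n. ennreal (- ln (1 - 2 * \<rho> n / \<bar>x - y\<bar>))) \<longlonglongrightarrow> 0" by simp
  have "eventually (\<lambda>n. \<rho> n < \<bar>x - y\<bar> / 4) sequentially"
    using assms by (intro order_tendstoD) auto
  then have "eventually (\<lambda>n. ennreal (- ln (1 - 2 * \<rho> n / \<bar>x - y\<bar>)) = smear_err (\<rho> n) x y) sequentially"
    by eventually_elim (simp add: smear_err_def)
  then show ?thesis by (rule Lim_transform_eventually[OF *])
qed

text \<open>Without atoms the diagonal is negligible, and off it the error tends to 0; the uniform
  bound 3 allows dominated convergence in the inner and then in the outer integral.\<close>

lemma smear_err_integral_tendsto_0:
  assumes [measurable_cong]: "sets N = sets borel" and "finite_measure N"
    and na: "\<And>x. emeasure N {x} = 0"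
    and \<rho>: "\<And>n. \<rho> n > 0" "\<rho> \<longlonglongrightarrow> 0"
  shows "(\<lambda>n. \<integral>\<^sup>+ x. (\<integral>\<^sup>+ y. smear_err (\<rho> n) x y \<partial>N) \<partial>N) \<longlonglongrightarrow> 0"
proof -
  interpret finite_measure N by fact
  have sp: "space N = UNIV" using sets_eq_imp_space_eq[OF assms(1)] by simp
  have fin: "ennreal C * emeasure N UNIV < \<infinity>" for C
    by (simp add: ennreal_mult_eq_top_iff less_top[symmetric] emeasure_eq_measure)
  have inner: "(\<lambda>n. \<integral>\<^sup>+ y. smear_err (\<rho> n) x y \<partial>N) \<longlonglongrightarrow> 0" for x
  proof -
    have ae: "AE y in N. y \<noteq> x"
      using na[of x] by (intro AE_I[where N="{x}"]) (auto simp: assms(1))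
    have "(\<lambda>n. \<integral>\<^sup>+ y. smear_err (\<rho> n) x y \<partial>N) \<longlonglongrightarrow> (\<integral>\<^sup>+ y. 0 \<partial>N)"
    proof (rule nn_integral_dominated_convergence[where w="\<lambda>_. ennreal 3"])
      show "AE y in N. (\<lambda>n. smear_err (\<rho> n) x y) \<longlonglongrightarrow> 0"
        using ae by eventually_elim (auto intro!: smear_err_tendsto_0 \<rho>)
    qed (use fin[of 3] in \<open>auto simp: sp smear_err_le[simplified] \<rho>\<close>)
    then show ?thesis by simp
  qed
  have b: "(\<integral>\<^sup>+ y. smear_err (\<rho> n) x y \<partial>N) \<le> ennreal 3 * emeasure N UNIV" for x n
  proof -
    have "(\<integral>\<^sup>+ y. smear_err (\<rho> n) x y \<partial>N) \<le> (\<integral>\<^sup>+ y. ennreal 3 \<partial>N)"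
      by (intro nn_integral_mono smear_err_le \<rho>)
    then show ?thesis by (simp add: sp)
  qed
  have "(\<lambda>n. \<integral>\<^sup>+ x. (\<integral>\<^sup>+ y. smear_err (\<rho> n) x y \<partial>N) \<partial>N) \<longlonglongrightarrow> (\<integral>\<^sup>+ y. 0 \<partial>N)"
    by (rule nn_integral_dominated_convergence[where w="\<lambda>_. ennreal 3 * emeasure N UNIV"])
      (use fin[of 3] inner b in \<open>auto simp: sp ennreal_mult_less_top emeasure_eq_measure\<close>)
  then show ?thesis by simp
qed

lemma smear_integral_le:
  assumes [measurable_cong]: "sets N = sets borel" and "finite_measure N"
    and "0 < r" "r \<le> \<rho>" "0 < s" "s \<le> \<rho>" "\<rho> \<le> 1"
  shows "(\<integral>\<^sup>+ x. (\<integral>\<^sup>+ y. smear r s x y \<partial>N) \<partial>N) \<le> energy N + (\<integral>\<^sup>+ x. (\<integral>\<^sup>+ y. smear_err \<rho> x y \<partial>N) \<partial>N)"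
proof -
  interpret finite_measure N by fact
  have "(\<integral>\<^sup>+ x. (\<integral>\<^sup>+ y. smear r s x y \<partial>N) \<partial>N) \<le> (\<integral>\<^sup>+ x. (\<integral>\<^sup>+ y. log_ker x y + smear_err \<rho> x y \<partial>N) \<partial>N)"
    using assms by (intro nn_integral_mono smear_le_err)
  also have "\<dots> = energy N + (\<integral>\<^sup>+ x. (\<integral>\<^sup>+ y. smear_err \<rho> x y \<partial>N) \<partial>N)"
    unfolding energy_def by (simp add: nn_integral_add)
  finally show ?thesis .
qed

lemma energy_density:
  assumes [measurable]: "\<phi> \<in> borel_measurable borel"
  shows "energy (density lborel \<phi>) = (\<integral>\<^sup>+ u. (\<integral>\<^sup>+ v. \<phi> u * (\<phi> v * log_ker u v) \<partial>lborel) \<partial>lborel)"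
  unfolding energy_def
  by (subst nn_integral_density; (subst nn_integral_density)?) (auto simp flip: nn_integral_cmult)

lemma energy_density_mono:
  assumes [measurable]: "\<phi> \<in> borel_measurable borel" "\<psi> \<in> borel_measurable borel" and "\<And>u. \<phi> u \<le> \<psi> u"
  shows "energy (density lborel \<phi>) \<le> energy (density lborel \<psi>)"
proof -
  have "\<phi> u * (\<phi> v * log_ker u v) \<le> \<psi> u * (\<psi> v * log_ker u v)" for u v
    by (rule mult_mono[OF assms(3) mult_right_mono[OF assms(3)]]) simp_all
  then show ?thesis
    unfolding energy_density[OF assms(1)] energy_density[OF assms(2)]
    by (intro nn_integral_mono) blast
qed

section \<open>Energy minimisation on the real line\<close>

text \<open>The counterpart of \<open>cap_measures\<close> on the line. A compact set of full
  measure replaces the topological support because it is easier to follow through densities, image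
  measures and weak limits.\<close>

definition carried :: "real set \<Rightarrow> real measure set" where
  "carried E = {N. sets N = sets borel \<and> prob_space N \<and> (\<exists>K. compact K \<and> K \<subseteq> E \<and> (AE x in N. x \<in> K))}"

lemma carriedI:
  "sets N = sets borel \<Longrightarrow> prob_space N \<Longrightarrow> compact K \<Longrightarrow> K \<subseteq> E \<Longrightarrow> AE x in N. x \<in> K \<Longrightarrow> N \<in> carried E"
  by (auto simp: carried_def)

lemma carried_mono: "E \<subseteq> F \<Longrightarrow> carried E \<subseteq> carried F"
  by (fastforce simp: carried_def)

text \<open>For \<open>E\<close> inside [0,1] the capacity of \<open>E\<close> is the exponential of
  minus this value, see \<open>INF_log_energy\<close>.\<close>

definition min_energy :: "real set \<Rightarrow> ennreal" where
  "min_energy E = (INF N\<in>carried E. energy N)"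

lemma min_energy_antimono: "E \<subseteq> F \<Longrightarrow> min_energy F \<le> min_energy E"
  unfolding min_energy_def by (intro INF_superset_mono carried_mono) auto

lemma min_energy_le: "N \<in> carried E \<Longrightarrow> min_energy E \<le> energy N"
  unfolding min_energy_def by (rule INF_lower)

lemma min_energy_less: "min_energy E < x \<Longrightarrow> \<exists>N\<in>carried E. energy N < x"
  by (simp add: min_energy_def INF_less_iff)

section \<open>Reduction of planar capacity to measures on the line\<close>

lemma AE_measure_support:
  assumes [measurable_cong]: "sets \<mu> = sets borel"
  shows "AE z in \<mu>. z \<in> measure_support \<mu>"
proof -
  define \<F> where "\<F> = {ball z e | z e. emeasure \<mu> (ball z e) = 0}"
  \<comment> \<open>The complement of the support is covered by null balls; by Lindelof countably
    many of them suffice, so their union is null.\<close>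
  obtain \<F>' where F': "\<F>' \<subseteq> \<F>" "countable \<F>'" "\<Union>\<F>' = \<Union>\<F>"
    using Lindelof[of \<F>] by (auto simp: \<F>_def)
  have "(\<Union>S\<in>\<F>'. S) \<in> null_sets \<mu>"
    using F' by (intro null_sets_UN') (auto simp: \<F>_def assms null_sets_def)
  then have "emeasure \<mu> (\<Union>\<F>') = 0" by auto
  moreover have "- measure_support \<mu> \<subseteq> \<Union>\<F>"
    by (force simp: measure_support_def \<F>_def)
  moreover have "\<Union>\<F>' \<in> sets \<mu>"
    using F' by (intro sets.countable_Union) (auto simp: \<F>_def assms)
  ultimately show ?thesis
    by (intro AE_I[where N="\<Union>\<F>'"]) (use F' in auto)
qed

lemma closed_measure_support:
  assumes "sets \<mu> = sets borel"
  shows "closed (measure_support \<mu>)"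
proof -
  have "open (- measure_support \<mu>)"
    unfolding open_contains_ball
  proof safe
    fix z assume "z \<notin> measure_support \<mu>"
    then obtain e where e: "e > 0" "emeasure \<mu> (ball z e) = 0" by (auto simp: measure_support_def)
    have "w \<notin> measure_support \<mu>" if "w \<in> ball z e" for w
    proof -
      have "ball w (e - dist z w) \<subseteq> ball z e"
        by (auto simp: subset_iff) (metis add.commute add_less_cancel_right diff_add_cancel dist_triangle le_less_trans less_diff_eq)
      then have "emeasure \<mu> (ball w (e - dist z w)) = 0"
        using emeasure_mono[of "ball w (e - dist z w)" "ball z e" \<mu>] e by (auto simp: assms)
      moreover have "e - dist z w > 0" using that by simp
      ultimately show ?thesis
        unfolding measure_support_def mem_Collect_eq by (metis less_irrefl)
    qed
    then show "\<exists>e>0. ball z e \<subseteq> - measure_support \<mu>" using e by blast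
  qed
  then show ?thesis by (simp add: closed_def)
qed

lemma measurable_log_kernel_pos [measurable (raw)]:
  assumes [measurable]: "g \<in> borel_measurable M" "h \<in> borel_measurable M"
  shows "(\<lambda>p. log_kernel_pos (g p) (h p)) \<in> borel_measurable M"
  unfolding log_kernel_pos_def by measurable

text \<open>The image measure under \<open>Re\<close> works: on the embedded line \<open>Re\<close>
  inverts the embedding, so the kernel is unchanged almost everywhere.\<close>

lemma cap_measures_imp_carried:
  assumes "\<mu> \<in> cap_measures (complex_of_real ` E)"
  obtains N where "N \<in> carried E"
    "(\<integral>\<^sup>+ z. (\<integral>\<^sup>+ w. log_kernel_pos z w \<partial>\<mu>) \<partial>\<mu>) = energy N"
    "AE z in \<mu>. z \<in> complex_of_real ` E"
proof -
  have s[measurable_cong]: "sets \<mu> = sets borel" and "prob_space \<mu>" and cK: "compact (measure_support \<mu>)"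
    and KE: "measure_support \<mu> \<subseteq> complex_of_real ` E"
    using assms by (auto simp: cap_measures_def)
  interpret prob_space \<mu> by fact
  define N where "N = distr \<mu> borel Re"
  have ae: "AE z in \<mu>. z \<in> measure_support \<mu>" by (rule AE_measure_support[OF s])
  then have aeE: "AE z in \<mu>. z \<in> complex_of_real ` E" by eventually_elim (use KE in auto)
  have cRe: "compact (Re ` measure_support \<mu>)"
    by (intro compact_continuous_image cK continuous_intros)
  have "AE x in N. x \<in> Re ` measure_support \<mu>"
    unfolding N_def using ae cRe by (subst AE_distr_iff) (auto simp: borel_compact)
  then have "N \<in> carried E"
    using cRe KE by (intro carriedI[of N "Re ` measure_support \<mu>"]) (auto simp: N_def intro!: prob_space_distr)
  moreover have "(\<integral>\<^sup>+ z. (\<integral>\<^sup>+ w. log_kernel_pos z w \<partial>\<mu>) \<partial>\<mu>) = energy N"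
  proof -
    have "energy N = (\<integral>\<^sup>+ z. (\<integral>\<^sup>+ w. log_ker (Re z) (Re w) \<partial>\<mu>) \<partial>\<mu>)"
      unfolding energy_def N_def by (simp add: nn_integral_distr)
    also have "\<dots> = (\<integral>\<^sup>+ z. (\<integral>\<^sup>+ w. log_kernel_pos z w \<partial>\<mu>) \<partial>\<mu>)"
    proof (rule nn_integral_cong_AE, use aeE in eventually_elim)
      fix z assume z: "z \<in> complex_of_real ` E"
      show "(\<integral>\<^sup>+ w. log_ker (Re z) (Re w) \<partial>\<mu>) = (\<integral>\<^sup>+ w. log_kernel_pos z w \<partial>\<mu>)"
        by (rule nn_integral_cong_AE, use aeE in eventually_elim) (use z in \<open>auto simp: log_ker_def\<close>)
    qed
    finally show ?thesis by simp
  qed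
  ultimately show ?thesis using aeE that by blast
qed

text \<open>The image under the embedding works. Its support lies in the image of the compact
  carrier, because any point outside has a ball that misses this image and hence is null.\<close>

lemma carried_imp_cap_measures:
  assumes "N \<in> carried E"
  obtains \<mu> where "\<mu> \<in> cap_measures (complex_of_real ` E)"
    "(\<integral>\<^sup>+ z. (\<integral>\<^sup>+ w. log_kernel_pos z w \<partial>\<mu>) \<partial>\<mu>) = energy N"
proof -
  obtain K where N[measurable_cong]: "sets N = sets borel" "prob_space N" 
    and K: "compact K" "K \<subseteq> E" "AE x in N. x \<in> K"
    using assms by (auto simp: carried_def)
  interpret prob_space N by fact
  define \<mu> where "\<mu> = distr N borel complex_of_real"
  have cK: "compact (complex_of_real ` K)"
    by (intro compact_continuous_image K continuous_intros)
  have sub: "measure_support \<mu> \<subseteq> complex_of_real ` K"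
  proof
    fix z assume z: "z \<in> measure_support \<mu>"
    show "z \<in> complex_of_real ` K"
    proof (rule ccontr)
      assume "z \<notin> complex_of_real ` K"
      then have "z \<in> - (complex_of_real ` K)" "open (- (complex_of_real ` K))"
        using compact_imp_closed[OF cK] by (auto simp: closed_def)
      then obtain e where e: "e > 0" "ball z e \<subseteq> - (complex_of_real ` K)"
        unfolding open_contains_ball by blast
      have "AE x in N. complex_of_real x \<notin> ball z e"
        using K(3) by eventually_elim (use e in auto)
      then have "AE w in \<mu>. w \<notin> ball z e" unfolding \<mu>_def by (subst AE_distr_iff) auto
      then have "emeasure \<mu> (ball z e) = 0"
        by (subst (asm) AE_iff_measurable[of "ball z e"]) (auto simp: \<mu>_def)
      moreover have "emeasure \<mu> (ball z e) > 0" using z e by (auto simp: measure_support_def)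
      ultimately show False by simp
    qed
  qed
  have "compact (measure_support \<mu>)"
    using compact_Int_closed[OF cK closed_measure_support[of \<mu>]] sub
    by (simp add: \<mu>_def Int_absorb1)
  moreover have "complex_of_real ` K \<subseteq> complex_of_real ` E" using K by auto
  ultimately have "\<mu> \<in> cap_measures (complex_of_real ` E)"
    using sub unfolding cap_measures_def by (auto simp: \<mu>_def intro!: prob_space_distr)
  moreover have "(\<integral>\<^sup>+ z. (\<integral>\<^sup>+ w. log_kernel_pos z w \<partial>\<mu>) \<partial>\<mu>) = energy N"
    unfolding energy_def \<mu>_def log_ker_def
    by (subst nn_integral_distr; (subst nn_integral_distr)?) auto
  ultimately show ?thesis by (rule that)
qed

text \<open>Distances within [0,1] are at most 1, so the negative part of the kernel vanishes almost
  everywhere.\<close>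

lemma log_energy_unit_interval:
  assumes "sets \<mu> = sets borel" "AE z in \<mu>. z \<in> complex_of_real ` {0..1}"
  shows "log_energy \<mu> = enn2ereal (\<integral>\<^sup>+ z. (\<integral>\<^sup>+ w. log_kernel_pos z w \<partial>\<mu>) \<partial>\<mu>)"
proof -
  have "(\<integral>\<^sup>+ z. (\<integral>\<^sup>+ w. log_kernel_neg z w \<partial>\<mu>) \<partial>\<mu>) = (\<integral>\<^sup>+ z. 0 \<partial>\<mu>)"
  proof (rule nn_integral_cong_AE, use assms(2) in eventually_elim)
    fix z assume z: "z \<in> complex_of_real ` {0..1}"
    have "(\<integral>\<^sup>+ w. log_kernel_neg z w \<partial>\<mu>) = (\<integral>\<^sup>+ w. 0 \<partial>\<mu>)"
    proof (rule nn_integral_cong_AE, use assms(2) in eventually_elim)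
      fix w assume "w \<in> complex_of_real ` {0..1}"
      then obtain x y where xy: "z = complex_of_real x" "w = complex_of_real y" "x \<in> {0..1}" "y \<in> {0..1}"
        using z by auto
      then have "cmod (z - w) \<le> 1" by (simp add: abs_le_iff flip: of_real_diff)
      then show "log_kernel_neg z w = 0" 
        by (cases "z = w") (auto simp: log_kernel_neg_def ennreal_eq_0_iff)
    qed
    then show "(\<integral>\<^sup>+ w. log_kernel_neg z w \<partial>\<mu>) = 0" by simp
  qed
  then show ?thesis
    by (simp add: log_energy_def zero_ennreal.rep_eq)
qed

lemma INF_log_energy:
  assumes "E \<subseteq> {0..1}"
  shows "(INF \<mu>\<in>cap_measures (complex_of_real ` E). log_energy \<mu>) = enn2ereal (min_energy E)"
proof (rule antisym)
  let ?X = "INF \<mu>\<in>cap_measures (complex_of_real ` E). log_energy \<mu>"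
  have eq: "log_energy \<mu> = enn2ereal (\<integral>\<^sup>+ z. (\<integral>\<^sup>+ w. log_kernel_pos z w \<partial>\<mu>) \<partial>\<mu>)"
    if "\<mu> \<in> cap_measures (complex_of_real ` E)" for \<mu>
  proof (rule log_energy_unit_interval)
    show "sets \<mu> = sets borel" using that by (simp add: cap_measures_def)
    obtain N where "AE z in \<mu>. z \<in> complex_of_real ` E" using cap_measures_imp_carried[OF \<open>\<mu> \<in> _\<close>] by blast
    then show "AE z in \<mu>. z \<in> complex_of_real ` {0..1}" by eventually_elim (use assms in auto)
  qed
  show "enn2ereal (min_energy E) \<le> ?X"
  proof (rule INF_greatest)
    fix \<mu> assume \<mu>: "\<mu> \<in> cap_measures (complex_of_real ` E)"
    obtain N where "N \<in> carried E" "(\<integral>\<^sup>+ z. (\<integral>\<^sup>+ w. log_kernel_pos z w \<partial>\<mu>) \<partial>\<mu>) = energy N"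
      using cap_measures_imp_carried[OF \<mu>] by blast
    then show "enn2ereal (min_energy E) \<le> log_energy \<mu>"
      using min_energy_le[of N E] by (simp add: eq[OF \<mu>] less_eq_ennreal.rep_eq)
  qed
  \<comment> \<open>Nonnegativity ensures that passing to \<open>ennreal\<close> and back does not
    change the infimum.\<close>
  have X0: "0 \<le> ?X" by (rule INF_greatest) (simp add: eq)
  have "e2ennreal ?X \<le> min_energy E"
    unfolding min_energy_def
  proof (rule INF_greatest)
    fix N assume "N \<in> carried E"
    then obtain \<mu> where \<mu>: "\<mu> \<in> cap_measures (complex_of_real ` E)"
        "(\<integral>\<^sup>+ z. (\<integral>\<^sup>+ w. log_kernel_pos z w \<partial>\<mu>) \<partial>\<mu>) = energy N"
      by (rule carried_imp_cap_measures)
    have "?X \<le> enn2ereal (energy N)" using INF_lower[OF \<mu>(1), of log_energy] by (simp add: eq[OF \<mu>(1)] \<mu>(2))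
    then show "e2ennreal ?X \<le> energy N" by (metis e2ennreal_enn2ereal e2ennreal_mono)
  qed
  then show "?X \<le> enn2ereal (min_energy E)"
    using X0 by (metis enn2ereal_e2ennreal less_eq_ennreal.rep_eq)
qed

lemma log_capacity_unit_interval_cong:
  "E \<subseteq> {0..1} \<Longrightarrow> F \<subseteq> {0..1} \<Longrightarrow> min_energy E = min_energy F \<Longrightarrow>
    log_capacity (complex_of_real ` E) = log_capacity (complex_of_real ` F)"
  by (simp add: log_capacity_def INF_log_energy)

lemma log_capacity_pos:
  assumes "E \<subseteq> {0..1}" "min_energy E < \<infinity>"
  shows "log_capacity (complex_of_real ` E) > 0"
proof -
  have "enn2ereal (min_energy E) \<noteq> PInfty" 
    using assms(2) by (cases "min_energy E") (auto simp: enn2ereal_ennreal)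
  then show ?thesis
    by (auto simp: log_capacity_def INF_log_energy[OF assms(1)] split: ereal.split)
qed

text \<open>\<open>E\<close> need not lie in [0,1], since for \<alpha> > 1 every outcome is
  considered, whatever its centres. An infinite positive part makes \<open>log_energy\<close>
  infinite for any negative part, as \<infinity> - \<infinity> equals \<infinity> in
  \<open>ereal\<close>.\<close>

lemma log_capacity_eq_0:
  assumes "\<And>N. N \<in> carried E \<Longrightarrow> energy N = \<infinity>"
  shows "log_capacity (complex_of_real ` E) = 0"
proof -
  have "log_energy \<mu> = \<infinity>" if \<mu>: "\<mu> \<in> cap_measures (complex_of_real ` E)" for \<mu>
  proof -
    obtain N where "N \<in> carried E" "(\<integral>\<^sup>+ z. (\<integral>\<^sup>+ w. log_kernel_pos z w \<partial>\<mu>) \<partial>\<mu>) = energy N"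
      using cap_measures_imp_carried[OF \<mu>] by blast
    then show ?thesis
      using assms[of N]
      by (cases "enn2ereal (\<integral>\<^sup>+ z. (\<integral>\<^sup>+ w. log_kernel_neg z w \<partial>\<mu>) \<partial>\<mu>)") (auto simp: log_energy_def)
  qed
  then have "(INF \<mu>\<in>cap_measures (complex_of_real ` E). log_energy \<mu>) = (INF \<mu>\<in>cap_measures (complex_of_real ` E). \<infinity>)"
    by (intro INF_cong) auto
  \<comment> \<open>An empty family of measures has infimum \<open>top\<close>, which is \<infinity>
    as well.\<close>
  also have "\<dots> = PInfty" by (cases "cap_measures (complex_of_real ` E) = {}") (auto simp: top_ereal_def)
  finally show ?thesis by (simp add: log_capacity_def)
qed

section \<open>Infinite energy on the limsup set for \<alpha> > 1\<close>

lemma energy_limsup_set: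
  assumes "lam > 0" "\<alpha> > 1" and N: "N \<in> carried (limsup_set lam \<alpha> c)"
  shows "energy N = \<infinity>"
proof (rule ccontr)
  assume "energy N \<noteq> \<infinity>"
  then have fin: "energy N < \<infinity>" by (simp add: less_top)
  define e where "e = enn2real (energy N)"
  have e: "energy N = ennreal e" "e \<ge> 0" using fin by (auto simp: e_def)
  obtain K where sN[measurable_cong]: "sets N = sets borel" and "prob_space N" 
    and K: "K \<subseteq> limsup_set lam \<alpha> c" "AE x in N. x \<in> K"
    using N by (auto simp: carried_def)
  interpret prob_space N by fact
  define l where "l k = exp (- lam * real k powr \<alpha>)" for k
  define q where "q k = lam * real k powr \<alpha>" for k
  have "summable (\<lambda>k. 1 / lam * real k powr (- \<alpha>))"
    using assms by (intro summable_mult) (simp add: summable_real_powr_iff)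
  then have "(\<lambda>m. \<Sum>k. 1 / lam * real (k + m) powr (- \<alpha>)) \<longlonglongrightarrow> 0"
    by (rule suminf_exist_split2)
  then have "\<forall>\<^sub>F m in sequentially. (\<Sum>k. 1 / lam * real (k + m) powr (- \<alpha>)) < 1 / (4 * (e + 1))"
    using e by (intro order_tendstoD) auto
  then have "\<forall>\<^sub>F m in sequentially. m \<ge> 1 \<and> (\<Sum>k. 1 / lam * real (k + m) powr (- \<alpha>)) < 1 / (4 * (e + 1))"
    using eventually_ge_at_top[of 1] by eventually_elim auto
  \<comment> \<open>The tail is so small that \<open>e\<close> times it is below 1/4, which
    Cauchy-Schwarz turns into a mass of at most 1/2. The bound \<open>m \<ge> 1\<close> matches the
    range of the intersection in \<open>limsup_set\<close> and makes all \<open>q (k + m)\<close>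
    positive.\<close>
  then obtain m where m: "m \<ge> 1" "(\<Sum>k. 1 / lam * real (k + m) powr (- \<alpha>)) < 1 / (4 * (e + 1))"
    by (auto dest: eventually_happens)
  define I where "I k = {c (k + m) - l (k + m) / 2 <..< c (k + m) + l (k + m) / 2}" for k
  \<comment> \<open>Disjointness makes the masses of the pieces add up to 1 and puts each pair
    \<open>(x, y)\<close> into at most one square \<open>J k \<times> J k\<close>.\<close>
  define J where "J = disjointed I"
  have "range I \<subseteq> sets borel" by (auto simp: I_def)
  then have rJ: "range J \<subseteq> sets borel" unfolding J_def by (rule sets.range_disjointed_sets)
  then have J[measurable]: "J k \<in> sets borel" for k by blast
  have Jdisj: "disjoint_family J" unfolding J_def by (rule disjoint_family_disjointed)
  have "AE x in N. x \<in> (\<Union>k. J k)"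
    using K(2)
  proof eventually_elim
    fix x assume "x \<in> K"
    then obtain k where "k \<ge> m" "x \<in> {c k - l k / 2 <..< c k + l k / 2}"
      using K(1) m(1) unfolding limsup_set_def l_def by blast
    then have "x \<in> I (k - m)" by (simp add: I_def)
    then show "x \<in> (\<Union>k. J k)" unfolding J_def UN_disjointed_eq by blast
  qed
  then have one: "prob (\<Union>k. J k) = 1" by (intro prob_eq_1[THEN iffD2]) auto
  have sums: "(\<lambda>k. prob (J k)) sums 1"
    using finite_measure_UNION[of J, unfolded sN, OF rJ Jdisj] unfolding one .
  have qpos: "q (k + m) > 0" for k using assms m by (simp add: q_def)
  \<comment> \<open>Two points of the same piece are at distance at most \<open>l (k + m)\<close>,
    so the kernel there is at least \<open>q (k + m)\<close>; integrating over the disjoint squares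
    bounds the sum by the energy.\<close>
  have diag: "(\<Sum>k<n. (prob (J k))\<^sup>2 * q (k + m)) \<le> e" for n
  proof -
    have "(\<Sum>k<n. ennreal (q (k + m)) * (indicator (J k) x * indicator (J k) y)) \<le> log_ker x y" for x y
    proof (cases "\<exists>k<n. x \<in> J k \<and> y \<in> J k")
      case True
      then obtain k where k: "k < n" "x \<in> J k" "y \<in> J k" by auto
      have z: "indicator (J i) x * indicator (J i) y = (0::ennreal)" if "i \<noteq> k" for i
        using Jdisj k that by (auto simp: disjoint_family_on_def indicator_def)
      have "(\<Sum>i<n. ennreal (q (i + m)) * (indicator (J i) x * indicator (J i) y)) =
            (\<Sum>i\<in>{k}. ennreal (q (i + m)) * (indicator (J i) x * indicator (J i) y))"
        using k z by (intro sum.mono_neutral_right) auto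
      also have "\<dots> = ennreal (q (k + m))" using k by simp
      also have "\<dots> \<le> log_ker x y"
      proof (cases "x = y")
        case False
        have "x \<in> I k" "y \<in> I k" using k disjointed_subset[of I k] by (auto simp: J_def)
        then have "\<bar>x - y\<bar> \<le> l (k + m)" by (auto simp: I_def)
        then have "ln \<bar>x - y\<bar> \<le> ln (l (k + m))" using False by (subst ln_le_cancel_iff) (auto simp: l_def)
        then show ?thesis using False by (auto simp: log_ker_altdef l_def q_def intro!: ennreal_leI)
      qed simp
      finally show ?thesis .
    next
      case False
      then have z: "(\<Sum>k<n. ennreal (q (k + m)) * (indicator (J k) x * indicator (J k) y)) = 0"
        by (intro sum.neutral) (auto simp: indicator_def)
      show ?thesis unfolding z by simp
    qed
    then have "(\<integral>\<^sup>+ x. (\<integral>\<^sup>+ y. (\<Sum>k<n. ennreal (q (k + m)) * (indicator (J k) x * indicator (J k) y)) \<partial>N) \<partial>N) \<le> energy N"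
      unfolding energy_def by (intro nn_integral_mono)
    also have "(\<integral>\<^sup>+ x. (\<integral>\<^sup>+ y. (\<Sum>k<n. ennreal (q (k + m)) * (indicator (J k) x * indicator (J k) y)) \<partial>N) \<partial>N)
       = (\<Sum>k<n. ennreal (q (k + m)) * (emeasure N (J k) * emeasure N (J k)))"
      by (simp add: nn_integral_sum nn_integral_cmult nn_integral_multc)
    also have "\<dots> = ennreal (\<Sum>k<n. (prob (J k))\<^sup>2 * q (k + m))"
      using qpos by (subst sum_ennreal[symmetric])
        (auto simp: emeasure_eq_measure less_imp_le power2_eq_square mult_ac simp flip: ennreal_mult intro!: sum.cong)
    finally show ?thesis using e by simp
  qed
  \<comment> \<open>Cauchy-Schwarz with the factors \<open>sqrt (q (k + m))\<close> and its
    reciprocal: one sum is bounded by the energy, the other is the small tail. Partial sums of at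
    most 1/2 contradict the total 1.\<close>
  have "(\<Sum>k<n. prob (J k)) \<le> 1 / 2" for n
  proof -
    have "(\<Sum>k<n. prob (J k))\<^sup>2 = (\<Sum>k<n. (prob (J k) * sqrt (q (k + m))) * (1 / sqrt (q (k + m))))\<^sup>2"
      using qpos by (simp add: less_imp_neq[symmetric])
    also have "\<dots> \<le> (\<Sum>k<n. (prob (J k) * sqrt (q (k + m)))\<^sup>2) * (\<Sum>k<n. (1 / sqrt (q (k + m)))\<^sup>2)"
      by (rule Cauchy_Schwarz_ineq_sum)
    also have "(\<Sum>k<n. (prob (J k) * sqrt (q (k + m)))\<^sup>2) = (\<Sum>k<n. (prob (J k))\<^sup>2 * q (k + m))"
      using qpos by (simp add: power_mult_distrib less_imp_le)
    also have "(\<Sum>k<n. (1 / sqrt (q (k + m)))\<^sup>2) = (\<Sum>k<n. 1 / lam * real (k + m) powr (- \<alpha>))"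
      using qpos by (simp add: power_divide less_imp_le) (simp add: q_def powr_minus field_simps)
    also have "(\<Sum>k<n. (prob (J k))\<^sup>2 * q (k + m)) * \<dots> \<le> e * (1 / (4 * (e + 1)))"
    proof (intro mult_mono diag)
      have "(\<Sum>k<n. 1 / lam * real (k + m) powr (- \<alpha>)) \<le> (\<Sum>k. 1 / lam * real (k + m) powr (- \<alpha>))"
        using assms \<open>summable (\<lambda>k. 1 / lam * real k powr (- \<alpha>))\<close>
        by (intro sum_le_suminf summable_ignore_initial_segment) auto
      then show "(\<Sum>k<n. 1 / lam * real (k + m) powr (- \<alpha>)) \<le> 1 / (4 * (e + 1))" using m by simp
    qed (use e assms in \<open>auto intro!: sum_nonneg\<close>)
    also have "\<dots> \<le> (1 / 2)\<^sup>2" using e by (simp add: field_simps power2_eq_square)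
    finally show ?thesis by (rule power2_le_imp_le) simp
  qed
  then have "(1::real) \<le> 1 / 2"
    using sums unfolding sums_def by (intro LIMSEQ_le_const2[of "\<lambda>n. \<Sum>k<n. prob (J k)"]) auto
  then show False by simp
qed

section \<open>Approximation and weak limits\<close>

text \<open>The kernel is continuous into [0, \<infinity>] also on the diagonal: small positive
  distances push the logarithm above any bound, and coinciding points already give
  \<infinity>.\<close>

lemma tendsto_log_ker:
  assumes "X \<longlonglongrightarrow> x" "Y \<longlonglongrightarrow> y"
  shows "(\<lambda>n. log_ker (X n) (Y n)) \<longlonglongrightarrow> log_ker x y"
proof (cases "x = y")
  case False
  have d: "(\<lambda>n. \<bar>X n - Y n\<bar>) \<longlonglongrightarrow> \<bar>x - y\<bar>" by (intro tendsto_intros assms)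
  have *: "(\<lambda>n. ennreal (- ln \<bar>X n - Y n\<bar>)) \<longlonglongrightarrow> ennreal (- ln \<bar>x - y\<bar>)"
    using False by (intro tendsto_intros assms) auto
  have "\<forall>\<^sub>F n in sequentially. \<bar>X n - Y n\<bar> > 0"
    using d False by (intro order_tendstoD) auto
  then have "\<forall>\<^sub>F n in sequentially. ennreal (- ln \<bar>X n - Y n\<bar>) = log_ker (X n) (Y n)"
    by eventually_elim (auto simp: log_ker_altdef)
  then show ?thesis using * False by (simp add: log_ker_altdef[of x y] Lim_transform_eventually)
next
  case True
  have d: "(\<lambda>n. \<bar>X n - Y n\<bar>) \<longlonglongrightarrow> \<bar>x - y\<bar>" by (intro tendsto_intros assms)
  have "\<forall>\<^sub>F n in sequentially. ennreal l < log_ker (X n) (Y n)" if "l \<ge> 0" for l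
  proof -
    have "\<forall>\<^sub>F n in sequentially. \<bar>X n - Y n\<bar> < exp (- l)"
      using d True by (intro order_tendstoD) auto
    then show ?thesis
    proof eventually_elim
      case (elim n)
      show ?case
      proof (cases "X n = Y n")
        case False
        then have "ln \<bar>X n - Y n\<bar> < ln (exp (- l))" using elim by (subst ln_less_cancel_iff) auto
        then show ?thesis using False that by (simp add: log_ker_altdef ennreal_less_iff)
      qed simp
    qed
  qed
  then show ?thesis using True by (simp add: tendsto_top_iff_ennreal)
qed

text \<open>Tightness yields a weakly convergent subsequence, and Skorohod's representation realises
  it by pointwise convergent variables. Closedness of the carriers then passes to the limit, and
  continuity of the kernel with Fatou applied twice bounds the energy.\<close>

lemma energy_weak_limit:
  assumes N: "\<And>n. sets (N n) = sets borel" "\<And>n. prob_space (N n)"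
    and C: "\<And>n. closed (C n)" "decseq C" "C 0 \<subseteq> {0..1}" "\<And>n. AE x in N n. x \<in> C n"
    and le: "\<And>n. energy (N n) \<le> b"
  obtains M where "sets M = sets borel" "prob_space M" "\<And>n. AE x in M. x \<in> C n" "energy M \<le> b"
proof -
  have rd: "real_distribution (N n)" for n
    using N by (simp add: real_distribution_def real_distribution_axioms_def)
  \<comment> \<open>Tightness is phrased with intervals open on the left, so the left end is moved
    below 0.\<close>
  have "measure (N n) {-1<..1} = 1" for n
  proof -
    interpret real_distribution "N n" by (rule rd)
    have "AE x in N n. x \<in> {-1<..1}"
      using C(4)[of n] by eventually_elim (use C(3) decseqD[OF C(2), of 0 n] in auto)
    then show ?thesis by (intro prob_eq_1[THEN iffD2]) auto
  qed
  then have "tight N"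
    unfolding tight_def using rd
    by (intro conjI allI impI exI[of _ "-1"] exI[of _ "1"]) auto
  from tight_imp_convergent_subsubsequence[OF this strict_mono_id]
  obtain r M where r: "strict_mono r" "real_distribution M" "weak_conv_m (N \<circ> id \<circ> r) M" by blast
  then have wc: "weak_conv_m (\<lambda>n. N (r n)) M" by (simp add: comp_def)
  obtain \<Omega> :: "real measure" and Yn Y where \<Omega>: "prob_space \<Omega>"
    and Yn[measurable]: "\<And>n. Yn n \<in> measurable \<Omega> borel" and dYn: "\<And>n. distr \<Omega> borel (Yn n) = N (r n)"
    and Y: "Y \<in> measurable \<Omega> lborel" and dY: "distr \<Omega> borel Y = M"
    and lim: "\<And>x. x \<in> space \<Omega> \<Longrightarrow> (\<lambda>n. Yn n x) \<longlonglongrightarrow> Y x"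
    using Skorohod[OF rd r(2) wc] by blast
  have [measurable]: "Y \<in> measurable \<Omega> borel" using Y by simp
  interpret \<Omega>: prob_space \<Omega> by fact
  interpret M: real_distribution M by (rule r(2))
  have "AE x in M. x \<in> C k" for k
  proof -
    have "AE w in \<Omega>. \<forall>n. Yn n w \<in> C (r n)"
      unfolding AE_all_countable
    proof
      fix n
      have "AE x in distr \<Omega> borel (Yn n). x \<in> C (r n)" unfolding dYn by (rule C(4))
      then show "AE w in \<Omega>. Yn n w \<in> C (r n)"
        using C(1) by (subst (asm) AE_distr_iff) auto
    qed
    then have "AE w in \<Omega>. Y w \<in> C k"
    proof (rule AE_mp, intro AE_I2 impI)
      fix w assume w: "w \<in> space \<Omega>" "\<forall>n. Yn n w \<in> C (r n)"
      have "\<forall>\<^sub>F n in sequentially. Yn n w \<in> C k"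
        using eventually_ge_at_top[of k]
      proof eventually_elim
        case (elim n)
        then have "C (r n) \<subseteq> C k"
          using decseqD[OF C(2), of k "r n"] strict_mono_imp_increasing[OF r(1), of n] by auto
        then show ?case using w by auto
      qed
      then show "Y w \<in> C k"
        using lim[OF w(1)] C(1) by (intro Lim_in_closed_set[of "C k" "\<lambda>n. Yn n w" sequentially]) auto
    qed
    then show ?thesis
      unfolding dY[symmetric] using C(1) by (subst AE_distr_iff) auto
  qed
  moreover have "energy M \<le> b"
  proof -
    have "energy M = (\<integral>\<^sup>+ u. (\<integral>\<^sup>+ v. log_ker (Y u) (Y v) \<partial>\<Omega>) \<partial>\<Omega>)"
      unfolding energy_def dY[symmetric] by (simp add: nn_integral_distr)
    also have "\<dots> = (\<integral>\<^sup>+ u. (\<integral>\<^sup>+ v. liminf (\<lambda>n. log_ker (Yn n u) (Yn n v)) \<partial>\<Omega>) \<partial>\<Omega>)"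
      by (intro nn_integral_cong lim_imp_Liminf[symmetric] tendsto_log_ker lim) auto
    also have "\<dots> \<le> (\<integral>\<^sup>+ u. liminf (\<lambda>n. \<integral>\<^sup>+ v. log_ker (Yn n u) (Yn n v) \<partial>\<Omega>) \<partial>\<Omega>)"
      by (intro nn_integral_mono nn_integral_liminf) measurable
    also have "\<dots> \<le> liminf (\<lambda>n. \<integral>\<^sup>+ u. (\<integral>\<^sup>+ v. log_ker (Yn n u) (Yn n v) \<partial>\<Omega>) \<partial>\<Omega>)"
      by (intro nn_integral_liminf) measurable
    also have "\<dots> = liminf (\<lambda>n. energy (N (r n)))"
      unfolding energy_def dYn[symmetric] by (simp add: nn_integral_distr)
    also have "\<dots> \<le> b"
      using le by (intro Liminf_le) auto
    finally show ?thesis .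
  qed
  ultimately show ?thesis
    by (intro that[of M]) (auto intro: M.prob_space_axioms)
qed

section \<open>Compact carriers and countable intersections of open sets\<close>

lemma compact_nbhd_subset_open:
  fixes K :: "real set"
  assumes "compact K" "open W" "K \<subseteq> W"
  obtains e L where "e > 0" "compact L" "L \<subseteq> W" "\<And>x. x \<in> K \<Longrightarrow> cball x e \<subseteq> L"
proof (cases "K = {}")
  \<comment> \<open>Treated apart because \<open>infdist\<close> to the empty set is 0 by
    convention.\<close>
  case True then show ?thesis by (intro that[of 1 "{}"]) auto
next
  case False
  obtain e where e: "e > 0" "(\<Union>x\<in>K. cball x e) \<subseteq> W"
    using compact_subset_open_imp_cball_epsilon_subset[OF assms] .
  define L where "L = {x. infdist x K \<le> e}"
  have "L \<subseteq> W"
  proof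
    fix u assume u: "u \<in> L"
    obtain x where "x \<in> K" "infdist u K = dist u x"
      using infdist_attains_inf[OF compact_imp_closed[OF assms(1)] False] by blast
    then show "u \<in> W" using u e by (auto simp: L_def dist_commute subset_iff)
  qed
  moreover have "cball x e \<subseteq> L" if "x \<in> K" for x
  proof
    fix u assume "u \<in> cball x e"
    then show "u \<in> L" using infdist_le[OF that, of u] by (simp add: L_def dist_commute)
  qed
  moreover have "compact L" unfolding L_def using False assms(1) e(1) by (rule compact_infdist_le)
  ultimately show ?thesis using e by (intro that)
qed

text \<open>The values \<open>min_energy (V \<inter> U n)\<close> for single \<open>n\<close> control the infinite intersection because
  compact carriers can be chosen nested, each inside the next open set.\<close>
lemma min_energy_Inter_le:
  fixes U :: "nat \<Rightarrow> real set"
  assumes base: "\<And>K W. compact K \<Longrightarrow> open W \<Longrightarrow> K \<subseteq> W \<Longrightarrow> \<exists>V\<in>\<V>. K \<subseteq> V \<and> V \<subseteq> W"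
    and opV: "\<And>V. V \<in> \<V> \<Longrightarrow> open V" and opU: "\<And>n. open (U n)"
    and le: "\<And>V n. V \<in> \<V> \<Longrightarrow> V \<subseteq> {0<..<1} \<Longrightarrow> min_energy (V \<inter> U n) \<le> min_energy V"
  shows "min_energy ({0..1} \<inter> (\<Inter>n. U n)) \<le> min_energy {0<..<1}"
proof (rule ccontr)
  assume "\<not> ?thesis"
  \<comment> \<open>A strict gap on both sides: the limit measure below is only known to have energy
    at most \<open>b\<close>.\<close>
  then obtain b where b: "min_energy {0<..<1} < b" "b < min_energy ({0..1} \<inter> (\<Inter>n. U n))"
    by (meson dense not_le)
  \<comment> \<open>A measure of energy below \<open>b\<close> on \<open>W\<close> lives on a
    compact set; a member of the base between this set and a small neighbourhood keeps the infimum
    below \<open>b\<close> and fits into a compact subset of \<open>W\<close>.\<close>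
  have refine: "\<exists>V\<in>\<V>. min_energy V < b \<and> (\<exists>L. compact L \<and> V \<subseteq> L \<and> L \<subseteq> W)"
    if W: "open W" "min_energy W < b" for W
  proof -
    obtain N where "N \<in> carried W" "energy N < b" using min_energy_less[OF W(2)] by blast
    then obtain K where N: "sets N = sets borel" "prob_space N" "energy N < b"
      and K: "compact K" "K \<subseteq> W" "AE x in N. x \<in> K"
      by (auto simp: carried_def)
    obtain e L where e: "e > 0" "compact L" "L \<subseteq> W" "\<And>x. x \<in> K \<Longrightarrow> cball x e \<subseteq> L"
      using compact_nbhd_subset_open[OF K(1) W(1) K(2)] by blast
    have "K \<subseteq> (\<Union>x\<in>K. ball x e)" "open (\<Union>x\<in>K. ball x e)" using e(1) by auto
    then obtain V where V: "V \<in> \<V>" "K \<subseteq> V" "V \<subseteq> (\<Union>x\<in>K. ball x e)" using base K(1) by blast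
    have "min_energy V \<le> energy N" using K N V by (intro min_energy_le carriedI[of N K]) auto
    moreover have "V \<subseteq> L" using V(3) e(4) by (force simp: subset_iff)
    ultimately show ?thesis using V e N by (intro bexI[of _ V]) auto
  qed
  define P where "P n V \<longleftrightarrow> V \<in> \<V> \<and> V \<subseteq> {0<..<1} \<and> min_energy V < b" for n :: nat and V
  define Q where "Q n V V' \<longleftrightarrow> (\<exists>L. compact L \<and> V' \<subseteq> L \<and> L \<subseteq> V \<inter> U n)" for n V V'
  \<comment> \<open>Each \<open>V (Suc n)\<close> sits in a compact \<open>L n\<close> inside
    \<open>V n \<inter> U n\<close>. The \<open>L n\<close> thus decrease, and measures on
    \<open>V (Suc n)\<close> are carried by \<open>L n\<close>.\<close>
  have "\<exists>V. \<forall>n. P n (V n) \<and> Q n (V n) (V (Suc n))"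
  proof (rule dependent_nat_choice)
    show "\<exists>V. P 0 V" using refine[of "{0<..<1}"] b(1) unfolding P_def by fastforce
    fix V n assume "P n V"
    then have V: "V \<in> \<V>" "V \<subseteq> {0<..<1}" "min_energy V < b" by (auto simp: P_def)
    have "open (V \<inter> U n)" "min_energy (V \<inter> U n) < b"
      using opV opU V le[of V n] by (auto intro: le_less_trans)
    from refine[OF this] show "\<exists>V'. P (Suc n) V' \<and> Q n V V'"
      using V(2) unfolding P_def Q_def by (meson inf.boundedE subset_trans)
  qed
  then obtain V where V: "\<And>n. P n (V n)" "\<And>n. Q n (V n) (V (Suc n))" by blast
  then have "\<forall>n. \<exists>L. compact L \<and> V (Suc n) \<subseteq> L \<and> L \<subseteq> V n \<inter> U n" by (auto simp: Q_def)
  then obtain L where L: "\<And>n. compact (L n)" "\<And>n. V (Suc n) \<subseteq> L n" "\<And>n. L n \<subseteq> V n \<inter> U n"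
    by metis
  have "\<exists>N\<in>carried (V (Suc n)). energy N < b" for n
    using V(1)[of "Suc n"] by (intro min_energy_less) (auto simp: P_def)
  then obtain N where N: "\<And>n. N n \<in> carried (V (Suc n))" "\<And>n. energy (N n) < b" by metis
  have dec: "decseq L" using L by (intro decseq_SucI) blast
  have L0: "L n \<subseteq> {0..1}" for n using L(3)[of n] V(1)[of n] by (force simp: P_def)
  have aeL: "AE x in N n. x \<in> L n" for n
    using N(1)[of n] L(2)[of n] by (auto simp: carried_def elim!: eventually_mono)
  \<comment> \<open>The weak limit is carried by every \<open>L n\<close>, hence by their
    intersection, a compact subset of all the \<open>U n\<close>.\<close>
  obtain M where M: "sets M = sets borel" "prob_space M" "\<And>n. AE x in M. x \<in> L n" "energy M \<le> b"
  proof (rule energy_weak_limit[of N L b])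
    show "sets (N n) = sets borel" "prob_space (N n)" for n using N(1) by (auto simp: carried_def)
    show "energy (N n) \<le> b" for n using N(2) by (rule less_imp_le)
    show "closed (L n)" for n by (rule compact_imp_closed) (rule L)
    show "decseq L" by (rule dec)
    show "L 0 \<subseteq> {0..1}" by (rule L0)
    show "AE x in N n. x \<in> L n" for n by (rule aeL)
  qed blast
  have "AE x in M. \<forall>n. x \<in> L n" using M(3) by (simp add: AE_all_countable)
  then have "AE x in M. x \<in> (\<Inter>n. L n)" by (simp add: INT_iff)
  moreover have "compact (\<Inter>n. L n)"
    by (rule compact_Inter) (use L(1) in auto)
  moreover have "(\<Inter>n. L n) \<subseteq> {0..1} \<inter> (\<Inter>n. U n)" using L0 L(3) by blast
  ultimately have "M \<in> carried ({0..1} \<inter> (\<Inter>n. U n))" using M by (intro carriedI) auto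
  then have "min_energy ({0..1} \<inter> (\<Inter>n. U n)) \<le> b" using min_energy_le M(4) order_trans by blast
  then show False using b(2) by simp
qed

section \<open>Energy of the unit interval\<close>

lemma min_energy_open_unit_interval: "min_energy {0<..<1} \<le> min_energy {0..1}"
proof -
  have *: "min_energy {0<..<1} \<le> energy N + ennreal (- ln (1 - 2 * \<delta>))"
    if N: "N \<in> carried {0..1}" and \<delta>: "0 < \<delta>" "\<delta> < 1 / 2" for N \<delta>
  proof -
    obtain K where sN[measurable_cong]: "sets N = sets borel" and "prob_space N" and K: "compact K" "K \<subseteq> {0..1}" "AE x in N. x \<in> K"
      using N by (auto simp: carried_def)
    interpret prob_space N by fact
    \<comment> \<open>An affine contraction of [0,1] into the open interval: it scales all distances
      by \<open>1 - 2 * \<delta>\<close> and so adds at most \<open>- ln (1 - 2 * \<delta>)\<close>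
      to the energy.\<close>
    define T where "T x = \<delta> + (1 - 2 * \<delta>) * x" for x
    have T[measurable]: "T \<in> borel_measurable borel" unfolding T_def by measurable
    have "T x \<in> {\<delta>..1 - \<delta>}" if "x \<in> {0..1}" for x
    proof -
      have "(1 - 2 * \<delta>) * x \<le> (1 - 2 * \<delta>) * 1" "0 \<le> (1 - 2 * \<delta>) * x" 
        using that \<delta> by (auto intro!: mult_left_mono mult_nonneg_nonneg)
      then show ?thesis by (simp add: T_def)
    qed
    then have "AE x in distr N borel T. x \<in> {\<delta>..1 - \<delta>}"
      using K by (subst AE_distr_iff) (auto elim!: eventually_mono)
    then have "distr N borel T \<in> carried {0<..<1}"
      using \<delta> by (intro carriedI[of _ "{\<delta>..1 - \<delta>}"] prob_space_distr) auto
    then have "min_energy {0<..<1} \<le> energy (distr N borel T)" by (rule min_energy_le)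
    also have "\<dots> = (\<integral>\<^sup>+ x. (\<integral>\<^sup>+ y. log_ker (T x) (T y) \<partial>N) \<partial>N)"
      unfolding energy_def by (simp add: nn_integral_distr)
    also have "\<dots> \<le> (\<integral>\<^sup>+ x. (\<integral>\<^sup>+ y. log_ker x y + ennreal (- ln (1 - 2 * \<delta>)) \<partial>N) \<partial>N)"
    proof (intro nn_integral_mono)
      fix x y
      show "log_ker (T x) (T y) \<le> log_ker x y + ennreal (- ln (1 - 2 * \<delta>))"
      proof (cases "x = y")
        case False
        have "T x - T y = (1 - 2 * \<delta>) * (x - y)" by (simp add: T_def algebra_simps)
        then have eq: "\<bar>T x - T y\<bar> = (1 - 2 * \<delta>) * \<bar>x - y\<bar>" using \<delta> by (simp add: abs_mult)
        have "ln \<bar>T x - T y\<bar> = ln (1 - 2 * \<delta>) + ln \<bar>x - y\<bar>"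
          unfolding eq using \<delta> False by (subst ln_mult) auto
        then have "ennreal (- ln \<bar>T x - T y\<bar>) \<le> ennreal (- ln \<bar>x - y\<bar>) + ennreal (- ln (1 - 2 * \<delta>))"
          using \<delta> by (intro ennreal_le_plus) auto
        moreover have "0 < \<bar>T x - T y\<bar>" unfolding eq using \<delta> False by simp
        ultimately show ?thesis using False by (auto simp: log_ker_altdef)
      qed simp
    qed
    also have "\<dots> = energy N + ennreal (- ln (1 - 2 * \<delta>))"
      unfolding energy_def by (simp add: nn_integral_add emeasure_space_1)
    finally show ?thesis .
  qed
  have "min_energy {0<..<1} \<le> energy N" if N: "N \<in> carried {0..1}" for N
  proof -
    \<comment> \<open>The summand 3 keeps \<delta> below 1/2 already for
      \<open>n = 0\<close>.\<close>
    define \<delta> where "\<delta> n = 1 / (real n + 3)" for n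
    have d: "\<delta> \<longlonglongrightarrow> 0" unfolding \<delta>_def by real_asymp
    have "(\<lambda>n. energy N + ennreal (- ln (1 - 2 * \<delta> n))) \<longlonglongrightarrow> energy N + ennreal (- ln (1 - 2 * 0))"
      by (intro tendsto_intros d) auto
    then have "(\<lambda>n. energy N + ennreal (- ln (1 - 2 * \<delta> n))) \<longlonglongrightarrow> energy N" by simp
    moreover have "0 < \<delta> n \<and> \<delta> n < 1 / 2" for n by (simp add: \<delta>_def)
    ultimately show ?thesis
      using *[OF N] by (intro LIMSEQ_le_const) blast+
  qed
  then show ?thesis unfolding min_energy_def[of "{0..1}"] by (intro INF_greatest)
qed

text \<open>The uniform distribution on [0,1] has finite energy: it is a \<open>smear\<close> with
  all four arguments 1/2.\<close>

lemma min_energy_unit_interval_finite: "min_energy {0..1} < \<infinity>"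
proof -
  define N where "N = density lborel (bump (1 / 2) (1 / 2))"
  have m[measurable]: "bump (1 / 2) (1 / 2) \<in> borel_measurable borel" by measurable
  have "prob_space N"
    unfolding N_def by (intro prob_spaceI) (simp add: emeasure_density nn_integral_bump)
  moreover have "x \<in> {0..1}" if "bump (1 / 2) (1 / 2) x > 0" for x :: real
  proof -
    have "\<bar>x - 1 / 2\<bar> \<le> 1 / 2" using that by (simp add: bump_def split: if_splits)
    then show ?thesis unfolding abs_le_iff by auto
  qed
  then have "AE x in N. x \<in> {0..1}"
    unfolding N_def by (subst AE_density) auto
  ultimately have "N \<in> carried {0..1}" by (intro carriedI[of N "{0..1}"]) (auto simp: N_def)
  moreover have "energy N = smear (1 / 2) (1 / 2) (1 / 2) (1 / 2)"
    unfolding N_def smear_def by (rule energy_density) fact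
  moreover have "\<dots> \<le> ennreal (1 - ln (1 / 2))" by (rule smear_le_ln) auto
  ultimately have "min_energy {0..1} \<le> ennreal (1 - ln (1 / 2))"
    using min_energy_le[of N "{0..1}"] by (metis order_trans)
  then show ?thesis by (rule le_less_trans) (simp add: less_top[symmetric])
qed

section \<open>Approximation by bounded densities\<close>

lemma energy_mixture_bump:
  assumes [measurable_cong]: "sets N = sets borel" and "prob_space N"
  shows "energy (density lborel (\<lambda>u. \<integral>\<^sup>+ x. bump r x u \<partial>N)) = (\<integral>\<^sup>+ x. (\<integral>\<^sup>+ y. smear r r x y \<partial>N) \<partial>N)"
proof -
  interpret N: prob_space N by fact
  interpret NL: pair_sigma_finite N lborel by unfold_locales
  have "energy (density lborel (\<lambda>u. \<integral>\<^sup>+ x. bump r x u \<partial>N)) =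
     (\<integral>\<^sup>+ u. (\<integral>\<^sup>+ v. (\<integral>\<^sup>+ x. bump r x u \<partial>N) * ((\<integral>\<^sup>+ y. bump r y v \<partial>N) * log_ker u v) \<partial>lborel) \<partial>lborel)"
    by (rule energy_density) measurable
  also have "\<dots> = (\<integral>\<^sup>+ u. (\<integral>\<^sup>+ v. (\<integral>\<^sup>+ x. (\<integral>\<^sup>+ y. bump r x u * (bump r y v * log_ker u v) \<partial>N) \<partial>N) \<partial>lborel) \<partial>lborel)"
    by (intro nn_integral_cong) (simp add: nn_integral_cmult nn_integral_multc)
  \<comment> \<open>Four applications of Fubini move the two integrals over \<open>N\<close> outside
    those over \<open>u\<close> and \<open>v\<close>, one exchange at a time.\<close>
  also have "\<dots> = (\<integral>\<^sup>+ u. (\<integral>\<^sup>+ x. (\<integral>\<^sup>+ v. (\<integral>\<^sup>+ y. bump r x u * (bump r y v * log_ker u v) \<partial>N) \<partial>lborel) \<partial>N) \<partial>lborel)"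
    by (intro nn_integral_cong NL.Fubini') measurable
  also have "\<dots> = (\<integral>\<^sup>+ x. (\<integral>\<^sup>+ u. (\<integral>\<^sup>+ v. (\<integral>\<^sup>+ y. bump r x u * (bump r y v * log_ker u v) \<partial>N) \<partial>lborel) \<partial>lborel) \<partial>N)"
    by (intro NL.Fubini') measurable
  also have "\<dots> = (\<integral>\<^sup>+ x. (\<integral>\<^sup>+ u. (\<integral>\<^sup>+ y. (\<integral>\<^sup>+ v. bump r x u * (bump r y v * log_ker u v) \<partial>lborel) \<partial>N) \<partial>lborel) \<partial>N)"
    by (intro nn_integral_cong NL.Fubini') measurable
  also have "\<dots> = (\<integral>\<^sup>+ x. (\<integral>\<^sup>+ y. (\<integral>\<^sup>+ u. (\<integral>\<^sup>+ v. bump r x u * (bump r y v * log_ker u v) \<partial>lborel) \<partial>lborel) \<partial>N) \<partial>N)"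
    by (intro nn_integral_cong NL.Fubini') measurable
  finally show ?thesis by (simp add: smear_def)
qed

lemma energy_plus_err_less:
  assumes "sets N = sets borel" and "finite_measure N" and "energy N < b"
    and "\<And>n. \<rho> n > 0" "\<rho> \<longlonglongrightarrow> 0"
  shows "\<forall>\<^sub>F n in sequentially. energy N + (\<integral>\<^sup>+ x. (\<integral>\<^sup>+ y. smear_err (\<rho> n) x y \<partial>N) \<partial>N) < b"
proof -
  have "energy N < \<infinity>" using assms(3) by (auto intro: less_le_trans)
  then have "(\<lambda>n. \<integral>\<^sup>+ x. (\<integral>\<^sup>+ y. smear_err (\<rho> n) x y \<partial>N) \<partial>N) \<longlonglongrightarrow> 0"
    using assms by (intro smear_err_integral_tendsto_0 energy_finite_imp_no_atoms) auto
  then have "(\<lambda>n. energy N + (\<integral>\<^sup>+ x. (\<integral>\<^sup>+ y. smear_err (\<rho> n) x y \<partial>N) \<partial>N)) \<longlonglongrightarrow> energy N + 0"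
    by (intro tendsto_add tendsto_const)
  then show ?thesis using assms(3) by (intro order_tendstoD) auto
qed

text \<open>Convolve \<open>N\<close> with a uniform distribution of small radius \<rho>: the
  density is at most \<open>1 / (2 * \<rho>)\<close>, it lives near the carrier of \<open>N\<close>,
  and the energy grows by at most an error that tends to 0.\<close>

lemma bounded_density_approx:
  assumes N: "N \<in> carried V" and V: "open V" and lt: "energy N < b"
  obtains g :: "real \<Rightarrow> ennreal" and B :: real and K where
    "g \<in> borel_measurable borel" "compact K" "K \<subseteq> V" "\<And>u. u \<notin> K \<Longrightarrow> g u = 0"
    "\<And>u. g u \<le> ennreal B" "(\<integral>\<^sup>+ u. g u \<partial>lborel) = 1" "energy (density lborel g) < b"
proof -
  obtain K where sN[measurable_cong]: "sets N = sets borel" and "prob_space N" and K: "compact K" "K \<subseteq> V" "AE x in N. x \<in> K"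
    using N by (auto simp: carried_def)
  interpret prob_space N by fact
  interpret NL: pair_sigma_finite N lborel by unfold_locales
  obtain e L where e: "e > 0" "compact L" "L \<subseteq> V" "\<And>x. x \<in> K \<Longrightarrow> cball x e \<subseteq> L"
    using compact_nbhd_subset_open[OF K(1) V K(2)] by blast
  \<comment> \<open>Radii up to \<open>e\<close> keep the density inside \<open>L\<close>; radii up
    to 1 are what the smearing estimates require.\<close>
  define \<rho> where "\<rho> n = min e 1 / (real n + 1)" for n
  have \<rho>: "\<rho> n > 0" "\<rho> n \<le> 1" "\<rho> n \<le> e" for n 
  proof -
    have "min e 1 / (real n + 1) \<le> min e 1 / 1" using e(1) by (intro divide_left_mono) auto
    then show "\<rho> n > 0" "\<rho> n \<le> 1" "\<rho> n \<le> e" using e(1) by (auto simp: \<rho>_def)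
  qed
  have "\<rho> \<longlonglongrightarrow> 0" unfolding \<rho>_def by real_asymp
  from eventually_happens'[OF _ energy_plus_err_less[OF sN _ lt \<rho>(1) this]]
  obtain n where n: "energy N + (\<integral>\<^sup>+ x. (\<integral>\<^sup>+ y. smear_err (\<rho> n) x y \<partial>N) \<partial>N) < b"
    by (auto intro: finite_measure_axioms)
  define g where "g u = (\<integral>\<^sup>+ x. bump (\<rho> n) x u \<partial>N)" for u
  show ?thesis
  proof (rule that[of g L "1 / (2 * \<rho> n)"])
    show "g \<in> borel_measurable borel" unfolding g_def by measurable
    show "g u = 0" if "u \<notin> L" for u
    proof -
      have "g u = (\<integral>\<^sup>+ x. 0 \<partial>N)" unfolding g_def
      proof (rule nn_integral_cong_AE, use K(3) in eventually_elim)
        fix x assume "x \<in> K"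
        then have "u \<notin> cball x (\<rho> n)" using e(4)[of x] that \<rho>(3)[of n] by (auto simp: subset_iff)
        then show "bump (\<rho> n) x u = 0" by (simp add: bump_def dist_real_def abs_minus_commute)
      qed
      then show ?thesis by simp
    qed
    have "g u \<le> (\<integral>\<^sup>+ x. ennreal (1 / (2 * \<rho> n)) \<partial>N)" for u
      unfolding g_def by (intro nn_integral_mono) (simp add: bump_def)
    then show "g u \<le> ennreal (1 / (2 * \<rho> n))" for u by (simp add: emeasure_space_1)
    have "(\<integral>\<^sup>+ u. g u \<partial>lborel) = (\<integral>\<^sup>+ x. (\<integral>\<^sup>+ u. bump (\<rho> n) x u \<partial>lborel) \<partial>N)"
      unfolding g_def by (intro NL.Fubini') measurable
    then show "(\<integral>\<^sup>+ u. g u \<partial>lborel) = 1" using \<rho>(1) by (simp add: nn_integral_bump emeasure_space_1)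
    have "energy (density lborel g) = (\<integral>\<^sup>+ x. (\<integral>\<^sup>+ y. smear (\<rho> n) (\<rho> n) x y \<partial>N) \<partial>N)"
      unfolding g_def by (rule energy_mixture_bump) fact+
    also have "\<dots> \<le> energy N + (\<integral>\<^sup>+ x. (\<integral>\<^sup>+ y. smear_err (\<rho> n) x y \<partial>N) \<partial>N)"
      using \<rho> by (intro smear_integral_le sN) (auto intro: finite_measure_axioms)
    finally show "energy (density lborel g) < b" using n by simp
  qed (use e in auto)
qed

section \<open>Random blocks\<close>

text \<open>The self-energy of the interval with index \<open>k\<close> has order
  \<open>k powr \<alpha>\<close>. With this weight its diagonal contribution has the order of the
  weight itself, so the diagonal is linear in the total weight while the remaining energy is
  quadratic.\<close>

definition wt :: "real \<Rightarrow> nat \<Rightarrow> real" where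
  "wt \<alpha> k = real k powr (- \<alpha>)"

definition rad :: "real \<Rightarrow> real \<Rightarrow> nat \<Rightarrow> real" where
  "rad lam \<alpha> k = exp (- lam * real k powr \<alpha>) / 4"

text \<open>\<open>mass_of\<close> and \<open>energy_of\<close> belong to the sum over \<open>k \<in> I\<close> of \<open>wt \<alpha> k * h (x k)\<close> times the uniform
  distribution on the interval of radius \<open>rad lam \<alpha> k\<close> (a quarter of the length, to stay inside the
  open interval) around \<open>x k\<close>; in a \<open>good_block\<close>, normalising this measure brings its energy below \<open>b\<close>.\<close>
definition mass_of :: "real \<Rightarrow> (real \<Rightarrow> real) \<Rightarrow> nat set \<Rightarrow> (nat \<Rightarrow> real) \<Rightarrow> real" where
  "mass_of \<alpha> h I x = (\<Sum>k\<in>I. wt \<alpha> k * h (x k))"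

definition energy_of :: "real \<Rightarrow> real \<Rightarrow> (real \<Rightarrow> real) \<Rightarrow> nat set \<Rightarrow> (nat \<Rightarrow> real) \<Rightarrow> ennreal" where
  "energy_of lam \<alpha> h I x = (\<Sum>j\<in>I. \<Sum>k\<in>I. ennreal (wt \<alpha> j * h (x j)) *
     (ennreal (wt \<alpha> k * h (x k)) * smear (rad lam \<alpha> j) (rad lam \<alpha> k) (x j) (x k)))"

definition good_block :: "real \<Rightarrow> real \<Rightarrow> (real \<Rightarrow> real) \<Rightarrow> real \<Rightarrow> nat set \<Rightarrow> (nat \<Rightarrow> real) \<Rightarrow> bool" where
  "good_block lam \<alpha> h b I x \<longleftrightarrow> mass_of \<alpha> h I x > 0 \<and> energy_of lam \<alpha> h I x \<le> ennreal (b * (mass_of \<alpha> h I x)\<^sup>2)"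

lemma rad_pos [simp]: "rad lam \<alpha> k > 0"
  by (simp add: rad_def)

lemma rad_le_1: "lam > 0 \<Longrightarrow> rad lam \<alpha> k \<le> 1"
  by (simp add: rad_def) (meson exp_le_one_iff le_less_trans mult_nonneg_nonneg neg_le_0_iff_le not_le one_less_numeral_iff order.strict_trans1 powr_ge_zero semiring_norm(76) less_imp_le)

lemma rad_antimono: "lam > 0 \<Longrightarrow> \<alpha> > 0 \<Longrightarrow> m \<le> k \<Longrightarrow> rad lam \<alpha> k \<le> rad lam \<alpha> m"
  by (auto simp: rad_def intro!: mult_left_mono powr_mono2)

lemma rad_tendsto_0: "lam > 0 \<Longrightarrow> \<alpha> > 0 \<Longrightarrow> rad lam \<alpha> \<longlonglongrightarrow> 0"
  unfolding rad_def by real_asymp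

lemma wt_nonneg [simp]: "wt \<alpha> k \<ge> 0"
  by (simp add: wt_def)

lemma wt_pos: "k \<ge> 1 \<Longrightarrow> wt \<alpha> k > 0"
  by (simp add: wt_def)

lemma wt_le_1: "\<alpha> > 0 \<Longrightarrow> k \<ge> 1 \<Longrightarrow> wt \<alpha> k \<le> 1"
  unfolding wt_def by (subst powr_minus) (simp add: field_simps ge_one_powr_ge_zero)

text \<open>This is where \<alpha> \<le> 1 enters: bounded block sums would make the series of
  \<open>k powr (- \<alpha>)\<close> converge.\<close>

lemma sum_wt_unbounded:
  assumes "\<alpha> \<le> 1"
  shows "\<exists>n. T \<le> (\<Sum>k\<in>{m..<n}. wt \<alpha> k)"
proof (rule ccontr)
  assume *: "\<not> ?thesis"
  have "summable (\<lambda>k. wt \<alpha> (k + m))"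
  proof (rule summableI_nonneg_bounded)
    fix n
    have "(\<Sum>k<n. wt \<alpha> (k + m)) = (\<Sum>k\<in>{m..<n + m}. wt \<alpha> k)"
      using sum.shift_bounds_nat_ivl[of "wt \<alpha>" 0 m n] by (simp add: lessThan_atLeast0)
    then show "(\<Sum>k<n. wt \<alpha> (k + m)) \<le> T" using * by (metis less_imp_le not_le)
  qed simp
  then have "summable (wt \<alpha>)" by (simp add: summable_iff_shift)
  then have "- \<alpha> < - 1" unfolding wt_def by (subst (asm) summable_real_powr_iff)
  then show False using assms by simp
qed

lemma energy_sum_bump:
  assumes "finite I"
  shows "energy (density lborel (\<lambda>u. \<Sum>k\<in>I. a k * bump (r k) (y k) u)) =
    (\<Sum>j\<in>I. \<Sum>k\<in>I. a j * (a k * smear (r j) (r k) (y j) (y k)))"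
proof -
  have "energy (density lborel (\<lambda>u. \<Sum>k\<in>I. a k * bump (r k) (y k) u)) =
     (\<integral>\<^sup>+ u. (\<integral>\<^sup>+ v. (\<Sum>j\<in>I. a j * bump (r j) (y j) u) * ((\<Sum>k\<in>I. a k * bump (r k) (y k) v) * log_ker u v) \<partial>lborel) \<partial>lborel)"
    by (rule energy_density) measurable
  also have "\<dots> = (\<integral>\<^sup>+ u. (\<integral>\<^sup>+ v. (\<Sum>j\<in>I. \<Sum>k\<in>I. a j * (a k * (bump (r j) (y j) u * (bump (r k) (y k) v * log_ker u v)))) \<partial>lborel) \<partial>lborel)"
    by (intro nn_integral_cong, simp only: sum_distrib_right, simp only: sum_distrib_left) (simp only: mult_ac)
  also have "\<dots> = (\<Sum>j\<in>I. \<Sum>k\<in>I. a j * (a k * smear (r j) (r k) (y j) (y k)))"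
    unfolding smear_def by (simp add: nn_integral_sum nn_integral_cmult)
  finally show ?thesis .
qed

text \<open>Energy is quadratic, so dividing the block measure by its mass \<open>Z\<close> divides
  the energy by the square of \<open>Z\<close>. Centres with \<open>h (x k) = 0\<close> receive no
  mass, hence only the other intervals must lie in \<open>W\<close>.\<close>

lemma good_block_imp_carried:
  assumes I: "finite I" and h: "\<And>x. h x \<ge> 0" and good: "good_block lam \<alpha> h b I x" and b: "b \<ge> 0"
    and W: "\<And>k. k \<in> I \<Longrightarrow> h (x k) \<noteq> 0 \<Longrightarrow> cball (x k) (rad lam \<alpha> k) \<subseteq> W"
  shows "\<exists>N\<in>carried W. energy N \<le> ennreal b"
proof -
  define Z where "Z = mass_of \<alpha> h I x"
  have Z: "Z > 0" and le: "energy_of lam \<alpha> h I x \<le> ennreal (b * Z\<^sup>2)"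
    using good by (auto simp: good_block_def Z_def)
  define a where "a k = ennreal (wt \<alpha> k * h (x k) / Z)" for k
  define N where "N = density lborel (\<lambda>u. \<Sum>k\<in>I. a k * bump (rad lam \<alpha> k) (x k) u)"
  define K where "K = (\<Union>k\<in>{k\<in>I. h (x k) \<noteq> 0}. cball (x k) (rad lam \<alpha> k))"
  have "(\<Sum>k\<in>I. a k) = ennreal (\<Sum>k\<in>I. wt \<alpha> k * h (x k) / Z)"
    unfolding a_def using Z h by (intro sum_ennreal) auto
  also have "(\<Sum>k\<in>I. wt \<alpha> k * h (x k) / Z) = 1"
    using Z unfolding Z_def mass_of_def by (simp flip: sum_divide_distrib)
  finally have "(\<Sum>k\<in>I. a k) = 1" by simp
  then have "prob_space N"
    unfolding N_def by (intro prob_spaceI)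
      (simp add: emeasure_density nn_integral_sum nn_integral_cmult nn_integral_bump)
  moreover have "AE u in N. u \<in> K"
    unfolding N_def
  proof (subst AE_density, measurable, intro AE_I2 impI)
    fix u assume "0 < (\<Sum>k\<in>I. a k * bump (rad lam \<alpha> k) (x k) u)"
    then have "(\<Sum>k\<in>I. a k * bump (rad lam \<alpha> k) (x k) u) \<noteq> 0" by simp
    then obtain k where k: "k \<in> I" "a k * bump (rad lam \<alpha> k) (x k) u \<noteq> 0"
      by (rule sum.not_neutral_contains_not_neutral)
    then have "h (x k) \<noteq> 0" "\<bar>u - x k\<bar> \<le> rad lam \<alpha> k" by (auto simp: a_def bump_def split: if_splits)
    then show "u \<in> K" using k by (auto simp: K_def dist_real_def abs_minus_commute)
  qed
  moreover have "compact K" unfolding K_def using I by (intro compact_UN) auto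
  moreover have "K \<subseteq> W" unfolding K_def using W by auto
  ultimately have "N \<in> carried W" by (intro carriedI[of N K]) (auto simp: N_def)
  moreover have "energy N \<le> ennreal b"
  proof -
    have a: "a k = ennreal (1 / Z) * ennreal (wt \<alpha> k * h (x k))" for k
      unfolding a_def using Z by (subst ennreal_mult'[symmetric]) (auto simp: divide_inverse mult_ac)
    have "energy N = (\<Sum>j\<in>I. \<Sum>k\<in>I. a j * (a k * smear (rad lam \<alpha> j) (rad lam \<alpha> k) (x j) (x k)))"
      unfolding N_def using I by (rule energy_sum_bump)
    also have "\<dots> = ennreal (1 / Z) * ennreal (1 / Z) * energy_of lam \<alpha> h I x"
      unfolding energy_of_def sum_distrib_left a by (simp add: mult_ac)
    also have "\<dots> \<le> ennreal (1 / Z) * ennreal (1 / Z) * ennreal (b * Z\<^sup>2)"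
      by (intro mult_left_mono le) auto
    also have "\<dots> = ennreal b"
      using Z b by (simp add: power2_eq_square flip: ennreal_mult)
    finally show ?thesis .
  qed
  ultimately show ?thesis by blast
qed

section \<open>Moment estimates for independent centres\<close>

locale iid_seq = prob_space P for P :: "'a measure" +
  fixes c :: "nat \<Rightarrow> 'a \<Rightarrow> real" and F :: "real measure" and lam \<alpha> :: real
  assumes indep: "indep_vars (\<lambda>_. borel) c {1..}"
    and law: "\<And>k. k \<ge> 1 \<Longrightarrow> distr P borel (c k) = F"
    and lam: "lam > 0" and \<alpha>: "0 < \<alpha>" "\<alpha> \<le> 1"
begin

lemma c_measurable: "k \<ge> 1 \<Longrightarrow> c k \<in> borel_measurable P"
  using indep by (auto simp: indep_vars_def)

lemma sets_F [measurable_cong]: "sets F = sets borel"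
  using law[of 1] by auto

lemma prob_space_F: "prob_space F"
  using law[of 1] prob_space_distr[OF c_measurable[of 1]] by auto

lemma finite_density:
  fixes h :: "real \<Rightarrow> real"
  assumes "\<And>x. h x \<le> M" and [measurable]: "h \<in> borel_measurable borel"
  shows "finite_measure (density F (\<lambda>x. ennreal (h x)))"
proof (rule finite_measureI)
  interpret F: prob_space F by (rule prob_space_F)
  have "emeasure (density F (\<lambda>x. ennreal (h x))) (space (density F (\<lambda>x. ennreal (h x)))) = (\<integral>\<^sup>+ x. ennreal (h x) \<partial>F)"
    by (subst emeasure_density) (auto intro!: nn_integral_cong)
  also have "\<dots> \<le> (\<integral>\<^sup>+ x. ennreal M \<partial>F)"
    using assms(1) by (intro nn_integral_mono ennreal_leI)
  also have "\<dots> = ennreal M" by (simp add: F.emeasure_space_1)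
  finally show "emeasure (density F (\<lambda>x. ennreal (h x))) (space (density F (\<lambda>x. ennreal (h x)))) \<noteq> \<infinity>"
    by (auto simp: top_unique)
qed

lemma pair_law:
  assumes jk: "j \<noteq> k" "j \<ge> 1" "k \<ge> 1"
  shows "distr P (borel \<Otimes>\<^sub>M borel) (\<lambda>\<omega>. (c j \<omega>, c k \<omega>)) = F \<Otimes>\<^sub>M F"
proof -
  let ?s = "case_bool j k"
  \<comment> \<open>Restricting to the disjoint singletons \<open>{j}\<close> and \<open>{k}\<close>
    reindexes the pair by \<open>bool\<close>, the shape in which \<open>indep_var\<close> is
    defined.\<close>
  have "indep_vars (\<lambda>i. PiM {?s i} (\<lambda>_. borel)) (\<lambda>i \<omega>. restrict (\<lambda>i. c i \<omega>) {?s i}) UNIV"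
    using jk by (intro indep_vars_restrict[OF indep]) (auto simp: disjoint_family_on_def split: bool.splits)
  then have "indep_vars (\<lambda>_. borel) (\<lambda>i \<omega>. (\<lambda>x. x (?s i)) (restrict (\<lambda>i. c i \<omega>) {?s i})) UNIV"
    by (rule indep_vars_compose2) auto
  then have "indep_var borel (c j) borel (c k)"
    unfolding indep_var_def by (rule indep_vars_cong[THEN iffD1, rotated -1]) (auto split: bool.splits)
  then show ?thesis
    using law jk unfolding indep_var_distribution_eq by simp
qed

lemma expectation_pair:
  assumes jk: "j \<noteq> k" "j \<ge> 1" "k \<ge> 1" and [measurable]: "case_prod G \<in> borel_measurable (borel \<Otimes>\<^sub>M borel)"
  shows "(\<integral>\<^sup>+ \<omega>. G (c j \<omega>) (c k \<omega>) \<partial>P) = (\<integral>\<^sup>+ x. (\<integral>\<^sup>+ y. G x y \<partial>F) \<partial>F)"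
proof -
  interpret F: prob_space F by (rule prob_space_F)
  have [measurable]: "c j \<in> borel_measurable P" "c k \<in> borel_measurable P" using jk by (auto intro: c_measurable)
  have "(\<integral>\<^sup>+ \<omega>. G (c j \<omega>) (c k \<omega>) \<partial>P) = (\<integral>\<^sup>+ p. case_prod G p \<partial>distr P (borel \<Otimes>\<^sub>M borel) (\<lambda>\<omega>. (c j \<omega>, c k \<omega>)))"
    by (subst nn_integral_distr) auto
  also have "\<dots> = (\<integral>\<^sup>+ x. (\<integral>\<^sup>+ y. G x y \<partial>F) \<partial>F)"
    unfolding pair_law[OF jk] by (subst F.nn_integral_fst[symmetric]) (auto cong: sets_pair_measure_cong measurable_cong_sets)
  finally show ?thesis .
qed

text \<open>For \<open>j \<noteq> k\<close> independence turns the expectation into a smeared energy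
  of \<open>density F h\<close>, which is at most \<open>b\<close>. For \<open>j = k\<close> the
  weight cancels the growth of the self-energy and leaves a multiple of the weight.\<close>

lemma expectation_energy_of:
  assumes [measurable]: "h \<in> borel_measurable borel" and h: "\<And>x. 0 \<le> h x" "\<And>x. h x \<le> M"
    and I: "finite I" "I \<subseteq> {m..}" "m \<ge> 1"
    and b: "energy (density F h) + (\<integral>\<^sup>+ x. (\<integral>\<^sup>+ y. smear_err (rad lam \<alpha> m) x y \<partial>density F h) \<partial>density F h) \<le> ennreal b"
    and b0: "b \<ge> 0"
  shows "(\<integral>\<^sup>+ \<omega>. energy_of lam \<alpha> h I (\<lambda>k. c k \<omega>) \<partial>P) \<le>
    ennreal (b * (sum (wt \<alpha>) I)\<^sup>2 + M\<^sup>2 * (lam + 3) * sum (wt \<alpha>) I)"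
proof -
  interpret F: prob_space F by (rule prob_space_F)
  have M0: "M \<ge> 0" using h[of 0] by linarith
  have I1: "k \<ge> 1" "k \<ge> m" if "k \<in> I" for k using I that by auto
  have [measurable]: "c k \<in> borel_measurable P" if "k \<in> I" for k using I1[OF that] by (auto intro: c_measurable)
  let ?T = "\<lambda>j k \<omega>. ennreal (wt \<alpha> j * h (c j \<omega>)) * (ennreal (wt \<alpha> k * h (c k \<omega>)) * smear (rad lam \<alpha> j) (rad lam \<alpha> k) (c j \<omega>) (c k \<omega>))"
  have sN: "sets (density F h) = sets borel" by (simp add: sets_F)
  have fN: "finite_measure (density F h)" using h(2) by (rule finite_density) fact
  have bound: "(\<integral>\<^sup>+ \<omega>. ?T j k \<omega> \<partial>P) \<le> ennreal (wt \<alpha> j * wt \<alpha> k * b + (if j = k then M\<^sup>2 * (lam + 3) * wt \<alpha> k else 0))"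
    if jk: "j \<in> I" "k \<in> I" for j k
  proof (cases "j = k")
    case False
    let ?S = "smear (rad lam \<alpha> j) (rad lam \<alpha> k)"
    have "(\<integral>\<^sup>+ \<omega>. ?T j k \<omega> \<partial>P) = (\<integral>\<^sup>+ x. (\<integral>\<^sup>+ y. ennreal (wt \<alpha> j * h x) * (ennreal (wt \<alpha> k * h y) * ?S x y) \<partial>F) \<partial>F)"
      using False jk I1 by (intro expectation_pair) auto
    also have "\<dots> = (\<integral>\<^sup>+ x. (\<integral>\<^sup>+ y. ennreal (wt \<alpha> j * wt \<alpha> k) * (ennreal (h x) * (ennreal (h y) * ?S x y)) \<partial>F) \<partial>F)"
      using h by (intro nn_integral_cong) (simp add: ennreal_mult mult_ac)
    also have "\<dots> = ennreal (wt \<alpha> j * wt \<alpha> k) * (\<integral>\<^sup>+ x. (\<integral>\<^sup>+ y. ?S x y \<partial>density F h) \<partial>density F h)"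
      by (subst nn_integral_density; (subst nn_integral_density)?) (auto simp: nn_integral_cmult)
    also have "\<dots> \<le> ennreal (wt \<alpha> j * wt \<alpha> k) * ennreal b"
    proof (intro mult_left_mono)
      have "(\<integral>\<^sup>+ x. (\<integral>\<^sup>+ y. ?S x y \<partial>density F h) \<partial>density F h) \<le> 
        energy (density F h) + (\<integral>\<^sup>+ x. (\<integral>\<^sup>+ y. smear_err (rad lam \<alpha> m) x y \<partial>density F h) \<partial>density F h)"
        using I1[OF jk(1)] I1[OF jk(2)] lam \<alpha>
        by (intro smear_integral_le sN fN rad_antimono rad_le_1) auto
      then show "(\<integral>\<^sup>+ x. (\<integral>\<^sup>+ y. ?S x y \<partial>density F h) \<partial>density F h) \<le> ennreal b" using b by (rule order_trans)
    qed simp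
    also have "\<dots> = ennreal (wt \<alpha> j * wt \<alpha> k * b)" using b0 by (simp add: ennreal_mult)
    finally show ?thesis using False by simp
  next
    case True
    define w where "w = wt \<alpha> k"
    have w: "0 < w" "w \<le> 1" using I1[OF jk(2)] \<alpha> by (auto simp: w_def wt_pos wt_le_1)
    \<comment> \<open>One of the two weights in the diagonal term cancels the factor
      \<open>k powr \<alpha>\<close> of the self-energy.\<close>
    have wk: "w * real k powr \<alpha> = 1"
      using I1[OF jk(2)] by (simp add: w_def wt_def flip: powr_add)
    have "ln (4::real) = 2 * ln 2" using ln_realpow[of 2 2] by simp
    then have ln4: "ln (4::real) \<le> 2" using ln_le_minus_one[of "2::real"] by simp
    have "ln (rad lam \<alpha> k) = - lam * real k powr \<alpha> - ln 4" by (simp add: rad_def ln_div)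
    \<comment> \<open>The constant 3 absorbs the 1 of the smearing bound and the \<open>ln 4\<close>
      from the factor 1/4 in \<open>rad\<close>.\<close>
    then have lr: "1 - ln (rad lam \<alpha> k) \<le> lam * real k powr \<alpha> + 3" using ln4 by simp
    have "?T k k \<omega> \<le> ennreal (M\<^sup>2 * (lam + 3) * w)" for \<omega>
    proof -
      have hM: "w * h (c k \<omega>) \<le> w * M" "0 \<le> w * h (c k \<omega>)" using w h by (auto intro!: mult_left_mono)
      have "?T k k \<omega> \<le> ennreal (w * M) * (ennreal (w * M) * ennreal (lam * real k powr \<alpha> + 3))"
      proof (intro mult_mono ennreal_leI)
        show "smear (rad lam \<alpha> k) (rad lam \<alpha> k) (c k \<omega>) (c k \<omega>) \<le> ennreal (lam * real k powr \<alpha> + 3)"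
          using smear_le_ln[OF rad_pos rad_le_1[OF lam] rad_pos] ennreal_leI[OF lr] by (rule order_trans)
      qed (use hM h in \<open>auto simp: w_def\<close>)
      also have "\<dots> = ennreal ((w * M) * ((w * M) * (lam * real k powr \<alpha> + 3)))"
        using w M0 lam by (simp add: ennreal_mult)
      also have "(w * M) * ((w * M) * (lam * real k powr \<alpha> + 3)) = M\<^sup>2 * w * (lam * (w * real k powr \<alpha>) + 3 * w)"
        by (simp add: algebra_simps power2_eq_square)
      also have "\<dots> \<le> M\<^sup>2 * w * (lam + 3)"
        unfolding wk using w by (intro mult_left_mono) auto
      finally show ?thesis by (simp add: mult_ac ennreal_leI)
    qed
    then have "(\<integral>\<^sup>+ \<omega>. ?T j k \<omega> \<partial>P) \<le> (\<integral>\<^sup>+ \<omega>. ennreal (M\<^sup>2 * (lam + 3) * w) \<partial>P)"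
      unfolding True by (intro nn_integral_mono)
    also have "\<dots> = ennreal (M\<^sup>2 * (lam + 3) * w)" by (simp add: emeasure_space_1)
    \<comment> \<open>The nonnegative term \<open>w * w * b\<close> is added so that the double sum
      over all pairs factors into a square.\<close>
    also have "\<dots> \<le> ennreal (w * w * b + M\<^sup>2 * (lam + 3) * w)" using w b0 by (intro ennreal_leI) auto
    finally show ?thesis using True by (simp add: w_def)
  qed
  have "(\<integral>\<^sup>+ \<omega>. energy_of lam \<alpha> h I (\<lambda>k. c k \<omega>) \<partial>P) = (\<Sum>j\<in>I. \<Sum>k\<in>I. \<integral>\<^sup>+ \<omega>. ?T j k \<omega> \<partial>P)"
  proof -
    have T: "?T j k \<in> borel_measurable P" if "j \<in> I" "k \<in> I" for j k
      using that by measurable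
    have "(\<integral>\<^sup>+ \<omega>. energy_of lam \<alpha> h I (\<lambda>k. c k \<omega>) \<partial>P) = (\<Sum>j\<in>I. \<integral>\<^sup>+ \<omega>. (\<Sum>k\<in>I. ?T j k \<omega>) \<partial>P)"
      unfolding energy_of_def by (intro nn_integral_sum borel_measurable_sum T)
    also have "\<dots> = (\<Sum>j\<in>I. \<Sum>k\<in>I. \<integral>\<^sup>+ \<omega>. ?T j k \<omega> \<partial>P)"
      by (intro sum.cong refl nn_integral_sum T)
    finally show ?thesis .
  qed
  also have "\<dots> \<le> (\<Sum>j\<in>I. \<Sum>k\<in>I. ennreal (wt \<alpha> j * wt \<alpha> k * b + (if j = k then M\<^sup>2 * (lam + 3) * wt \<alpha> k else 0)))"
    by (intro sum_mono bound)
  also have "\<dots> = ennreal (\<Sum>j\<in>I. \<Sum>k\<in>I. wt \<alpha> j * wt \<alpha> k * b + (if j = k then M\<^sup>2 * (lam + 3) * wt \<alpha> k else 0))"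
    using b0 lam by (subst sum_ennreal[symmetric]; (subst sum_ennreal[symmetric])?) (auto intro!: sum_nonneg add_nonneg_nonneg)
  also have "(\<Sum>j\<in>I. \<Sum>k\<in>I. wt \<alpha> j * wt \<alpha> k * b + (if j = k then M\<^sup>2 * (lam + 3) * wt \<alpha> k else 0)) =
     b * (sum (wt \<alpha>) I)\<^sup>2 + M\<^sup>2 * (lam + 3) * sum (wt \<alpha>) I"
  proof -
    have "(\<Sum>j\<in>I. \<Sum>k\<in>I. wt \<alpha> j * wt \<alpha> k * b) = b * (sum (wt \<alpha>) I)\<^sup>2"
      by (simp add: power2_eq_square sum_product sum_distrib_left mult_ac)
    moreover have "(\<Sum>j\<in>I. \<Sum>k\<in>I. if j = k then M\<^sup>2 * (lam + 3) * wt \<alpha> k else 0) = M\<^sup>2 * (lam + 3) * sum (wt \<alpha>) I"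
      using I(1) by (simp add: sum_distrib_left)
    ultimately show ?thesis by (simp only: sum.distrib)
  qed
  finally show ?thesis .
qed

text \<open>A second-moment argument: the mean energy stays below \<open>q\<close> times the second
  moment of the mass by a margin of order the square of \<open>L\<close>. Since the mass never
  exceeds \<open>M * L\<close>, the good event must make up for this margin. The resulting bound
  does not depend on the block.\<close>

lemma block_prob:
  assumes [measurable]: "h \<in> borel_measurable borel" and h: "\<And>x. 0 \<le> h x" "\<And>x. h x \<le> M"
    and I: "finite I" "I \<subseteq> {m..}" "m \<ge> 1" and L: "L = sum (wt \<alpha>) I" "L > 0" "M\<^sup>2 * (lam + 3) \<le> d / 2 * L"
    and b: "energy (density F h) + (\<integral>\<^sup>+ x. (\<integral>\<^sup>+ y. smear_err (rad lam \<alpha> m) x y \<partial>density F h) \<partial>density F h) \<le> ennreal b"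
    and b0: "b \<ge> 0" and a: "a = (\<integral>x. h x \<partial>F)" and d: "d > 0" "b + d \<le> q * a\<^sup>2"
  shows "d / (2 * q * M\<^sup>2) \<le> prob {\<omega> \<in> space P. good_block lam \<alpha> h q I (\<lambda>k. c k \<omega>)}"
proof -
  interpret F: prob_space F by (rule prob_space_F)
  have M0: "M \<ge> 0" using h[of 0] by linarith
  have I1: "k \<ge> 1" "k \<ge> m" if "k \<in> I" for k using I that by auto
  have [measurable]: "c k \<in> borel_measurable P" if "k \<in> I" for k using I1[OF that] by (auto intro: c_measurable)
  have q: "q > 0"
  proof (rule ccontr)
    assume "\<not> q > 0"
    then have "q * a\<^sup>2 \<le> 0" by (intro mult_nonpos_nonneg) auto
    then show False using b0 d by linarith
  qed
  define Z where "Z \<omega> = mass_of \<alpha> h I (\<lambda>k. c k \<omega>)" for \<omega>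
  define A where "A \<omega> = energy_of lam \<alpha> h I (\<lambda>k. c k \<omega>)" for \<omega>
  define D where "D = {\<omega> \<in> space P. good_block lam \<alpha> h q I (\<lambda>k. c k \<omega>)}"
  have Z[measurable]: "Z \<in> borel_measurable P" unfolding Z_def mass_of_def by measurable
  have A[measurable]: "A \<in> borel_measurable P" unfolding A_def energy_of_def by measurable
  have Deq: "D = {\<omega> \<in> space P. Z \<omega> > 0 \<and> A \<omega> \<le> ennreal (q * (Z \<omega>)\<^sup>2)}"
    unfolding D_def good_block_def Z_def A_def by simp
  have D[measurable]: "D \<in> events" unfolding Deq by measurable
  have Z0: "0 \<le> Z \<omega>" for \<omega> unfolding Z_def mass_of_def using h by (intro sum_nonneg) auto
  have ZM: "Z \<omega> \<le> M * L" for \<omega>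
    unfolding Z_def mass_of_def L(1) sum_distrib_left using h
    by (intro sum_mono) (simp add: mult.commute[of M] mult_left_mono)
  have intZ: "integrable P Z"
    by (rule integrable_const_bound[of _ "M * L"]) (auto simp: Z0 ZM)
  have intZ2: "integrable P (\<lambda>\<omega>. (Z \<omega>)\<^sup>2)"
    by (rule integrable_const_bound[of _ "(M * L)\<^sup>2"]) (auto simp: Z0 ZM intro!: power_mono)
  have hc: "integrable P (\<lambda>\<omega>. h (c k \<omega>))" if "k \<in> I" for k
    using that by (intro integrable_const_bound[of _ M]) (auto simp: h)
  have "expectation Z = (\<Sum>k\<in>I. wt \<alpha> k * expectation (\<lambda>\<omega>. h (c k \<omega>)))"
    unfolding Z_def mass_of_def using hc by (subst Bochner_Integration.integral_sum) auto
  also have "\<dots> = (\<Sum>k\<in>I. wt \<alpha> k * a)"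
  proof (intro sum.cong refl)
    fix k assume k: "k \<in> I"
    have "a = integral\<^sup>L (distr P borel (c k)) h" unfolding a using law I1(1)[OF k] by simp
    also have "\<dots> = expectation (\<lambda>\<omega>. h (c k \<omega>))" using k by (subst integral_distr) auto
    finally show "wt \<alpha> k * expectation (\<lambda>\<omega>. h (c k \<omega>)) = wt \<alpha> k * a" by simp
  qed
  also have "\<dots> = a * L" unfolding L(1) by (simp add: sum_distrib_left mult_ac)
  finally have EZ: "expectation Z = a * L" .
  have EZ2: "(a * L)\<^sup>2 \<le> expectation (\<lambda>\<omega>. (Z \<omega>)\<^sup>2)"
    using variance_eq[OF intZ intZ2] variance_positive[of Z] EZ by simp
  \<comment> \<open>Off \<open>D\<close> either the mass is 0 or the energy exceeds \<open>q\<close>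
    times its square, so \<open>A\<close> alone suffices; on \<open>D\<close> the bound
    \<open>Z \<le> M * L\<close> is used.\<close>
  have "ennreal (q * (Z \<omega>)\<^sup>2) \<le> A \<omega> + ennreal (q * (M * L)\<^sup>2) * indicator D \<omega>" if "\<omega> \<in> space P" for \<omega>
  proof (cases "\<omega> \<in> D")
    case True
    have "ennreal (q * (Z \<omega>)\<^sup>2) \<le> ennreal (q * (M * L)\<^sup>2)"
      using q Z0 ZM by (intro ennreal_leI mult_left_mono power_mono) auto
    then show ?thesis using True by (simp add: add_increasing)
  next
    case False
    then show ?thesis using that Z0[of \<omega>] by (cases "Z \<omega> = 0") (auto simp: Deq not_le less_imp_le)
  qed
  then have "(\<integral>\<^sup>+ \<omega>. ennreal (q * (Z \<omega>)\<^sup>2) \<partial>P) \<le> (\<integral>\<^sup>+ \<omega>. A \<omega> + ennreal (q * (M * L)\<^sup>2) * indicator D \<omega> \<partial>P)"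
    by (rule nn_integral_mono)
  also have "\<dots> = (\<integral>\<^sup>+ \<omega>. A \<omega> \<partial>P) + ennreal (q * (M * L)\<^sup>2) * ennreal (prob D)"
    by (subst nn_integral_add) (auto simp: nn_integral_cmult_indicator emeasure_eq_measure)
  also have "\<dots> \<le> ennreal (b * L\<^sup>2 + M\<^sup>2 * (lam + 3) * L) + ennreal (q * (M * L)\<^sup>2) * ennreal (prob D)"
    unfolding A_def L(1) using I b b0 by (intro add_right_mono expectation_energy_of h) auto
  also have "\<dots> = ennreal (b * L\<^sup>2 + M\<^sup>2 * (lam + 3) * L + q * (M * L)\<^sup>2 * prob D)"
  proof -
    have "ennreal (q * (M * L)\<^sup>2) * ennreal (prob D) = ennreal (q * (M * L)\<^sup>2 * prob D)"
      using q by (intro ennreal_mult[symmetric]) auto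
    then show ?thesis using q b0 L(2) lam by (subst ennreal_plus) auto
  qed
  also have "(\<integral>\<^sup>+ \<omega>. ennreal (q * (Z \<omega>)\<^sup>2) \<partial>P) = ennreal (q * expectation (\<lambda>\<omega>. (Z \<omega>)\<^sup>2))"
    using q intZ2 by (subst nn_integral_eq_integral) auto
  finally have "q * expectation (\<lambda>\<omega>. (Z \<omega>)\<^sup>2) \<le> b * L\<^sup>2 + M\<^sup>2 * (lam + 3) * L + q * (M * L)\<^sup>2 * prob D"
    using q b0 L(2) lam by (subst (asm) ennreal_le_iff) (auto intro!: add_nonneg_nonneg)
  moreover have "q * (a * L)\<^sup>2 \<le> q * expectation (\<lambda>\<omega>. (Z \<omega>)\<^sup>2)" using EZ2 q by simp
  moreover have "(b + d) * L\<^sup>2 \<le> q * (a * L)\<^sup>2"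
    using mult_right_mono[OF d(2), of "L\<^sup>2"] by (simp add: power_mult_distrib mult_ac)
  \<comment> \<open>The total weight \<open>L\<close> is so large that the linear diagonal term uses
    up only half of the margin \<open>d\<close>.\<close>
  moreover have "M\<^sup>2 * (lam + 3) * L \<le> d / 2 * L\<^sup>2"
    using mult_right_mono[OF L(3), of L] L(2) by (simp add: power2_eq_square mult_ac)
  ultimately have "(b + d) * L\<^sup>2 \<le> b * L\<^sup>2 + d / 2 * L\<^sup>2 + q * (M * L)\<^sup>2 * prob D" by linarith
  then have "d / 2 * L\<^sup>2 \<le> (q * M\<^sup>2 * prob D) * L\<^sup>2" by (simp add: algebra_simps power_mult_distrib)
  then have "d / 2 \<le> q * M\<^sup>2 * prob D" using L(2) by (subst (asm) mult_le_cancel_right) auto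
  then have "d / (2 * q * M\<^sup>2) \<le> prob D"
    using q M0 d by (cases "M = 0") (auto simp: field_simps)
  then show ?thesis unfolding D_def .
qed

text \<open>The event depends only on the coordinates in \<open>I\<close>, so events for disjoint
  blocks are independent.\<close>

lemma good_block_restrict: "good_block lam \<alpha> h q I (restrict x I) = good_block lam \<alpha> h q I x"
  by (simp add: good_block_def mass_of_def energy_of_def)

text \<open>Choose infinitely many disjoint blocks beyond \<open>m1\<close>, each good with
  probability at least a fixed \<open>p > 0\<close>. By independence the first \<open>n + 1\<close>
  all fail with probability at most \<open>(1 - p) ^ Suc n\<close>.\<close>

lemma AE_good_block:
  assumes h_meas[measurable]: "h \<in> borel_measurable borel" and h: "\<And>x. 0 \<le> h x" "\<And>x. h x \<le> M"
    and a: "a = (\<integral>x. h x \<partial>F)" and lt: "energy (density F h) < ennreal (q * a\<^sup>2)" and q: "q > 0"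
  shows "AE \<omega> in P. \<exists>m\<ge>m1. \<exists>n. good_block lam \<alpha> h q {m..<n} (\<lambda>k. c k \<omega>)"
proof -
  interpret F: prob_space F by (rule prob_space_F)
  have sN: "sets (density F h) = sets borel" by (simp add: sets_F)
  have fN: "finite_measure (density F h)" using h(2) by (rule finite_density) fact
  \<comment> \<open>Two gaps are reserved: the one below \<open>b\<close> absorbs the smearing
    error, the one from \<open>b\<close> up to \<open>q\<close> times the square of \<open>a\<close>
    absorbs the diagonal.\<close>
  obtain b where b: "energy (density F h) < ennreal b" "ennreal b < ennreal (q * a\<^sup>2)" "b \<ge> 0"
  proof -
    obtain y where "energy (density F h) < y" "y < ennreal (q * a\<^sup>2)" using dense[OF lt] by blast
    then show ?thesis using that[of "enn2real y"] by (cases y) auto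
  qed
  have bq: "b < q * a\<^sup>2" using b by (simp add: ennreal_less_iff)
  define d where "d = q * a\<^sup>2 - b"
  have d: "d > 0" "b + d \<le> q * a\<^sup>2" using bq by (auto simp: d_def)
  have "M \<noteq> 0"
  proof
    assume "M = 0"
    then have "h = (\<lambda>_. 0)" using h by (intro ext antisym) auto
    then have "a = 0" using a by simp
    then show False using bq b(3) by simp
  qed
  define p where "p = d / (2 * q * M\<^sup>2)"
  have p: "p > 0" using d q \<open>M \<noteq> 0\<close> by (simp add: p_def)
  have "\<forall>\<^sub>F n in sequentially. energy (density F h) + 
      (\<integral>\<^sup>+ x. (\<integral>\<^sup>+ y. smear_err (rad lam \<alpha> n) x y \<partial>density F h) \<partial>density F h) < ennreal b"
    using b(1) by (intro energy_plus_err_less sN fN rad_tendsto_0 lam \<alpha>) auto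
  then obtain m0 where m0: "\<And>m. m \<ge> m0 \<Longrightarrow> energy (density F h) + 
      (\<integral>\<^sup>+ x. (\<integral>\<^sup>+ y. smear_err (rad lam \<alpha> m) x y \<partial>density F h) \<partial>density F h) \<le> ennreal b"
    unfolding eventually_sequentially using less_imp_le by blast
  have ex: "\<exists>n>m. p \<le> prob {\<omega> \<in> space P. good_block lam \<alpha> h q {m..<n} (\<lambda>k. c k \<omega>)}"
    if m: "m \<ge> m0" "m \<ge> 1" for m
  proof -
    \<comment> \<open>The second entry of the maximum is the block weight required by
      \<open>block_prob\<close>; the entry 1 makes the weight positive and the block
      nonempty.\<close>
    obtain n where n: "max 1 (2 * M\<^sup>2 * (lam + 3) / d) \<le> sum (wt \<alpha>) {m..<n}"
      using sum_wt_unbounded[OF \<alpha>(2)] by blast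
    have "n > m" using n by (cases "n > m") auto
    moreover have "p \<le> prob {\<omega> \<in> space P. good_block lam \<alpha> h q {m..<n} (\<lambda>k. c k \<omega>)}"
      unfolding p_def
      by (rule block_prob[OF h_meas h _ _ m(2) refl _ _ m0[OF m(1)] b(3) a d]) 
         (use n d in \<open>auto simp: field_simps\<close>)
    ultimately show ?thesis by blast
  qed
  define nx where "nx m = (SOME n. n > m \<and> p \<le> prob {\<omega> \<in> space P. good_block lam \<alpha> h q {m..<n} (\<lambda>k. c k \<omega>)})" for m
  have nx: "nx m > m" "p \<le> prob {\<omega> \<in> space P. good_block lam \<alpha> h q {m..<nx m} (\<lambda>k. c k \<omega>)}"
    if "m \<ge> m0" "m \<ge> 1" for m
    using someI_ex[OF ex[OF that]] unfolding nx_def by auto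
  \<comment> \<open>Block boundaries: iterate \<open>nx\<close> from a start beyond the requested
    \<open>m1\<close>, beyond \<open>m0\<close> where the smearing error is small, and beyond the
    unconstrained index 0.\<close>
  define ms where "ms i = (nx ^^ i) (max m1 (max m0 1))" for i
  have ms_Suc: "ms (Suc i) = nx (ms i)" for i by (simp add: ms_def)
  have ms: "ms i \<ge> max m1 (max m0 1)" for i
  proof (induction i)
    case 0 show ?case by (simp add: ms_def)
  next
    case (Suc i)
    then show ?case using nx(1)[of "ms i"] unfolding ms_Suc by linarith
  qed
  have inc: "ms i < ms (Suc i)" for i unfolding ms_Suc using ms[of i] by (intro nx) auto
  then have mono: "strict_mono ms" by (rule strict_mono_Suc_iff[THEN iffD2, rule_format])
  define K where "K i = {ms i..<ms (Suc i)}" for i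
  have disj: "disjoint_family K"
    unfolding disjoint_family_on_def K_def
  proof (intro ballI impI)
    fix i j :: nat assume "i \<noteq> j"
    then have "Suc i \<le> j \<or> Suc j \<le> i" by linarith
    then have "ms (Suc i) \<le> ms j \<or> ms (Suc j) \<le> ms i"
      using strict_mono_less_eq[OF mono] by blast
    then show "{ms i..<ms (Suc i)} \<inter> {ms j..<ms (Suc j)} = {}" by auto
  qed
  have K1: "K i \<subseteq> {1..}" for i using ms[of i] by (auto simp: K_def)
  define B where "B i \<omega> = good_block lam \<alpha> h q (K i) (\<lambda>k. c k \<omega>)" for i \<omega>
  have "indep_vars (\<lambda>i. PiM (K i) (\<lambda>_. borel)) (\<lambda>i \<omega>. restrict (\<lambda>k. c k \<omega>) (K i)) UNIV"
    using K1 disj by (intro indep_vars_restrict[OF indep]) auto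
  \<comment> \<open>Goodness is a measurable function of the restricted vector of each block and so
    inherits independence from these vectors.\<close>
  then have "indep_vars (\<lambda>_. count_space UNIV) (\<lambda>i \<omega>. good_block lam \<alpha> h q (K i) (restrict (\<lambda>k. c k \<omega>) (K i))) UNIV"
  proof (rule indep_vars_compose2)
    fix i :: nat
    have pred: "Measurable.pred M (\<lambda>x. 0 < Z x \<and> E x \<le> ennreal (q * (Z x)\<^sup>2))"
      if [measurable]: "Z \<in> borel_measurable M" "E \<in> borel_measurable M" for M :: "(nat \<Rightarrow> real) measure" and Z E
    proof -
      have "(\<lambda>x. ennreal (q * (Z x)\<^sup>2)) \<in> borel_measurable M" by measurable
      then have "{x \<in> space M. E x \<le> ennreal (q * (Z x)\<^sup>2)} \<in> sets M"
        by (intro borel_measurable_le that)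
      then have "Measurable.pred M (\<lambda>x. E x \<le> ennreal (q * (Z x)\<^sup>2))" by (simp add: pred_def)
      moreover have "Measurable.pred M (\<lambda>x. 0 < Z x)" by measurable
      ultimately show ?thesis by (intro pred_intros_logic)
    qed
    have [measurable]: "(\<lambda>x. x k) \<in> measurable (PiM (K i) (\<lambda>_. borel)) borel" if "k \<in> K i" for k
      using that by (rule measurable_component_singleton)
    have "mass_of \<alpha> h (K i) \<in> borel_measurable (PiM (K i) (\<lambda>_. borel))"
      unfolding mass_of_def[abs_def] by measurable
    moreover have "(\<lambda>x. ennreal (wt \<alpha> j * h (x j)) * (ennreal (wt \<alpha> k * h (x k)) * smear (rad lam \<alpha> j) (rad lam \<alpha> k) (x j) (x k)))
        \<in> borel_measurable (PiM (K i) (\<lambda>_. borel))" if "j \<in> K i" "k \<in> K i" for j k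
      using that by measurable
    then have "energy_of lam \<alpha> h (K i) \<in> borel_measurable (PiM (K i) (\<lambda>_. borel))"
      unfolding energy_of_def[abs_def] by (intro borel_measurable_sum)
    ultimately show "good_block lam \<alpha> h q (K i) \<in> measurable (PiM (K i) (\<lambda>_. borel)) (count_space UNIV)"
      unfolding good_block_def[abs_def] by (rule pred)
  qed
  then have iB: "indep_vars (\<lambda>_. count_space UNIV) B UNIV"
    unfolding good_block_restrict B_def[abs_def] .
  have Bm[measurable]: "B i \<in> measurable P (count_space UNIV)" for i
    using iB by (auto simp: indep_vars_def)
  have pB: "p \<le> prob {\<omega> \<in> space P. B i \<omega>}" for i
    unfolding B_def K_def ms_Suc using ms[of i] by (intro nx) auto
  have "prob {\<omega> \<in> space P. \<forall>i. \<not> B i \<omega>} \<le> (1 - p) ^ Suc n" for n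
  proof -
    have "{\<omega> \<in> space P. \<forall>i. \<not> B i \<omega>} \<subseteq> (\<Inter>i\<in>{..n}. B i -` {False} \<inter> space P)" by auto
    moreover have "(\<Inter>i\<in>{..n}. B i -` {False} \<inter> space P) \<in> events"
      by (intro sets.finite_INT) (auto intro!: measurable_sets[OF Bm])
    ultimately have "prob {\<omega> \<in> space P. \<forall>i. \<not> B i \<omega>} \<le> prob (\<Inter>i\<in>{..n}. B i -` {False} \<inter> space P)"
      by (intro finite_measure_mono)
    also have "\<dots> = (\<Prod>i\<in>{..n}. prob (B i -` {False} \<inter> space P))"
      by (rule indep_varsD[OF iB]) auto
    also have "\<dots> \<le> (\<Prod>i\<in>{..n}. 1 - p)"
    proof (intro prod_mono conjI)
      fix i
      have "B i -` {False} \<inter> space P = space P - {\<omega> \<in> space P. B i \<omega>}" by auto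
      then have "prob (B i -` {False} \<inter> space P) = 1 - prob {\<omega> \<in> space P. B i \<omega>}"
        by (simp add: prob_compl)
      then show "prob (B i -` {False} \<inter> space P) \<le> 1 - p" using pB[of i] by simp
    qed simp
    finally show ?thesis by simp
  qed
  moreover have "(\<lambda>n. (1 - p) ^ Suc n) \<longlonglongrightarrow> 0"
    using p order_trans[OF pB[of 0] prob_le_1] by (intro LIMSEQ_Suc LIMSEQ_power_zero) simp
  ultimately have "prob {\<omega> \<in> space P. \<forall>i. \<not> B i \<omega>} \<le> 0"
    by (intro LIMSEQ_le_const) auto
  then have "prob {\<omega> \<in> space P. \<forall>i. \<not> B i \<omega>} = 0" by (simp add: measure_le_0_iff)
  then have "AE \<omega> in P. \<not> (\<forall>i. \<not> B i \<omega>)"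
    by (subst AE_iff_measurable[OF _ refl]) (auto simp: emeasure_eq_measure)
  then show ?thesis
  proof eventually_elim
    case (elim \<omega>)
    then obtain i where "B i \<omega>" by blast
    then show ?case using ms[of i] unfolding B_def K_def by (intro exI[of _ "ms i"]) auto
  qed
qed

end

section \<open>The limsup set\<close>

lemma cball_rad_subset:
  "cball x (rad lam \<alpha> k) \<subseteq> {x - exp (- lam * real k powr \<alpha>) / 2 <..< x + exp (- lam * real k powr \<alpha>) / 2}"
proof
  fix u assume "u \<in> cball x (rad lam \<alpha> k)"
  then have "\<bar>u - x\<bar> \<le> exp (- lam * real k powr \<alpha>) / 4"
    by (simp add: rad_def dist_real_def abs_minus_commute)
  then have "u - x \<le> exp (- lam * real k powr \<alpha>) / 4" "x - u \<le> exp (- lam * real k powr \<alpha>) / 4"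
    by linarith+
  moreover have "exp (- lam * real k powr \<alpha>) > 0" by simp
  ultimately show "u \<in> {x - exp (- lam * real k powr \<alpha>) / 2 <..< x + exp (- lam * real k powr \<alpha>) / 2}"
    unfolding greaterThanLessThan_iff by linarith
qed

section \<open>Energy minima after intersecting with late intervals\<close>

context iid_seq
begin

definition tail_union :: "nat \<Rightarrow> 'a \<Rightarrow> real set" where
  "tail_union m \<omega> = (\<Union>k\<in>{m..}.
     {c k \<omega> - exp (- lam * real k powr \<alpha>) / 2 <..< c k \<omega> + exp (- lam * real k powr \<alpha>) / 2})"

lemma open_tail_union: "open (tail_union m \<omega>)"
  unfolding tail_union_def by auto

text \<open>Replace a near-optimal measure on \<open>V\<close> by a bounded density \<open>g\<close>
  and imitate \<open>g\<close> by reweighting the law \<open>f\<close> with a truncation of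
  \<open>g / f\<close>. Good blocks for this weight then give measures on late intervals inside
  \<open>V\<close>.\<close>

lemma AE_min_energy_tail_union_le:
  fixes f :: "real \<Rightarrow> real"
  assumes F: "F = density lborel (\<lambda>x. ennreal (f x))" and [measurable]: "f \<in> borel_measurable borel"
    and f: "\<And>x. f x \<ge> 0" "AE x in lborel. x \<in> {0..1} \<longrightarrow> f x > 0"
    and V: "open V" "V \<subseteq> {0<..<1}" and lt: "min_energy V < b"
  shows "AE \<omega> in P. min_energy (V \<inter> tail_union m \<omega>) \<le> b"
proof -
  interpret F: prob_space F by (rule prob_space_F)
  obtain N where N: "N \<in> carried V" "energy N < b" using min_energy_less[OF lt] by blast
  obtain y where y: "energy N < y" "y < b" using dense[OF N(2)] by blast
  obtain g :: "real \<Rightarrow> ennreal" and B :: real and K where g[measurable]: "g \<in> borel_measurable borel"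
    and K: "compact K" "K \<subseteq> V" "\<And>u. u \<notin> K \<Longrightarrow> g u = 0"
    and B: "\<And>u. g u \<le> ennreal B" and g1: "(\<integral>\<^sup>+ u. g u \<partial>lborel) = 1" and Eg: "energy (density lborel g) < y"
    by (rule bounded_density_approx[OF N(1) V(1) y(1)]) (rule that; assumption)
  obtain q where q: "q \<ge> 0" "y = ennreal q" using y by (cases y) auto
  obtain e where e: "e \<ge> 0" "energy (density lborel g) = ennreal e" using Eg by (cases "energy (density lborel g)") auto
  have eq: "e < q" using Eg e q by (simp add: ennreal_less_iff)
  have gfin: "g u < \<infinity>" for u by (rule le_less_trans[OF B]) simp
  \<comment> \<open>The truncation bounds \<open>h n\<close> by \<open>n\<close>, as the block
    estimates require, and keeps its product with \<open>f\<close> below \<open>g\<close>, so the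
    energy does not grow.\<close>
  define h where "h n x = (if f x > 0 \<and> g x \<le> ennreal (real n * f x) then enn2real (g x) / f x else 0)" for n :: nat and x
  have h[measurable]: "h n \<in> borel_measurable borel" for n unfolding h_def by measurable
  have h0: "0 \<le> h n x" for n x by (simp add: h_def)
  have hn: "h n x \<le> real n" for n x
  proof (cases "f x > 0 \<and> g x \<le> ennreal (real n * f x)")
    case True
    then have "enn2real (g x) \<le> real n * f x"
      using f(1) by (intro enn2real_leI) auto
    then show ?thesis using True by (simp add: h_def field_simps)
  qed (auto simp: h_def)
  have fh: "ennreal (f x) * ennreal (h n x) = (if f x > 0 \<and> g x \<le> ennreal (real n * f x) then g x else 0)" for n x
  proof (cases "f x > 0 \<and> g x \<le> ennreal (real n * f x)")
    case True
    then have "f x * h n x = enn2real (g x)" by (simp add: h_def)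
    then have "ennreal (f x) * ennreal (h n x) = ennreal (enn2real (g x))"
      using f(1) h0 by (simp flip: ennreal_mult)
    also have "\<dots> = g x" using gfin[of x] by simp
    finally show ?thesis using True by simp
  qed (auto simp: h_def)
  have dens: "density F (h n) = density lborel (\<lambda>x. ennreal (f x) * ennreal (h n x))" for n
    unfolding F by (subst density_density_eq) auto
  have energy_le: "energy (density F (h n)) \<le> ennreal e" for n
    unfolding e(2)[symmetric] dens by (rule energy_density_mono) (auto simp: fh)
  define a where "a n = (\<integral>x. h n x \<partial>F)" for n
  have int: "integrable F (h n)" for n
    by (rule F.integrable_const_bound[of _ "real n"]) (auto simp: h0 hn sets_F cong: measurable_cong_sets)
  have a: "ennreal (a n) = (\<integral>\<^sup>+ x. ennreal (f x) * ennreal (h n x) \<partial>lborel)" for n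
  proof -
    have "ennreal (a n) = (\<integral>\<^sup>+ x. ennreal (h n x) \<partial>F)"
      unfolding a_def using int h0 by (intro nn_integral_eq_integral[symmetric]) auto
    also have "\<dots> = (\<integral>\<^sup>+ x. ennreal (f x) * ennreal (h n x) \<partial>lborel)"
      unfolding F by (subst nn_integral_density) auto
    finally show ?thesis .
  qed
  \<comment> \<open>Only mass could be lost, and it returns in the limit: \<open>g\<close> vanishes
    off \<open>K\<close>, and almost everywhere on \<open>K\<close> positivity of \<open>f\<close>
    removes the truncation for large \<open>n\<close>.\<close>
  have "(\<lambda>n. \<integral>\<^sup>+ x. ennreal (f x) * ennreal (h n x) \<partial>lborel) \<longlonglongrightarrow> (\<integral>\<^sup>+ x. g x \<partial>lborel)"
  proof (rule nn_integral_dominated_convergence[where w=g])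
    show "AE x in lborel. (\<lambda>n. ennreal (f x) * ennreal (h n x)) \<longlonglongrightarrow> g x"
      using f(2)
    proof eventually_elim
      fix x assume fx: "x \<in> {0..1} \<longrightarrow> f x > 0"
      show "(\<lambda>n. ennreal (f x) * ennreal (h n x)) \<longlonglongrightarrow> g x"
      proof (cases "x \<in> K")
        case False
        then have "ennreal (f x) * ennreal (h n x) = g x" for n unfolding fh using K(3) by simp
        then show ?thesis by simp
      next
        case True
        then have fp: "f x > 0" using fx K V by force
        have "\<forall>\<^sub>F n in sequentially. ennreal (f x) * ennreal (h n x) = g x"
          using eventually_ge_at_top[of "nat \<lceil>enn2real (g x) / f x\<rceil>"]
        proof eventually_elim
          case (elim n)
          then have "enn2real (g x) / f x \<le> real n" by linarith
          then have "enn2real (g x) \<le> real n * f x" using fp by (simp add: field_simps)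
          then have "g x \<le> ennreal (real n * f x)"
            using gfin[of x] by (metis ennreal_enn2real ennreal_leI infinity_ennreal_def)
          then show ?case using fp by (simp add: fh)
        qed
        then show ?thesis by (rule tendsto_eventually)
      qed
    qed
  qed (auto simp: fh g1)
  then have "(\<lambda>n. ennreal (a n)) \<longlonglongrightarrow> ennreal 1" using a g1 by simp
  moreover have a0: "a n \<ge> 0" for n unfolding a_def by (intro Bochner_Integration.integral_nonneg h0)
  ultimately have "a \<longlonglongrightarrow> 1" by (subst (asm) tendsto_ennreal_iff) auto
  then have "(\<lambda>n. q * (a n)\<^sup>2) \<longlonglongrightarrow> q * 1\<^sup>2" by (intro tendsto_intros)
  then have "\<forall>\<^sub>F n in sequentially. e < q * (a n)\<^sup>2" using eq by (intro order_tendstoD) auto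
  then obtain n where n: "e < q * (a n)\<^sup>2" by (auto dest: eventually_happens)
  have lt': "energy (density F (h n)) < ennreal (q * (a n)\<^sup>2)"
    using energy_le[of n] n e(1) by (auto intro: le_less_trans simp: ennreal_less_iff)
  have q0: "q > 0" using eq e(1) by simp
  obtain r L where r: "r > 0" "L \<subseteq> V" "\<And>x. x \<in> K \<Longrightarrow> cball x r \<subseteq> L"
    by (rule compact_nbhd_subset_open[OF K(1) V(1) K(2)]) (rule that; assumption)
  have "\<forall>\<^sub>F k in sequentially. rad lam \<alpha> k < r"
    using rad_tendsto_0[OF lam \<alpha>(1)] r(1) by (rule order_tendstoD)
  \<comment> \<open>From \<open>k0\<close> on, an interval centred in \<open>K\<close> is shorter
    than the room left around \<open>K\<close> in \<open>V\<close>.\<close>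
  then obtain k0 where k0: "\<And>k. k \<ge> k0 \<Longrightarrow> rad lam \<alpha> k < r" unfolding eventually_sequentially by blast
  have "AE \<omega> in P. \<exists>m'\<ge>max m k0. \<exists>n'. good_block lam \<alpha> (h n) q {m'..<n'} (\<lambda>k. c k \<omega>)"
    by (rule AE_good_block[OF h h0 hn a_def lt' q0])
  then show ?thesis
  proof eventually_elim
    case (elim \<omega>)
    then obtain m' n' where m': "m' \<ge> m" "m' \<ge> k0" and good: "good_block lam \<alpha> (h n) q {m'..<n'} (\<lambda>k. c k \<omega>)"
      by auto
    have "cball (c k \<omega>) (rad lam \<alpha> k) \<subseteq> V \<inter> tail_union m \<omega>" if k: "k \<in> {m'..<n'}" and "h n (c k \<omega>) \<noteq> 0" for k
    proof -
      have "g (c k \<omega>) \<noteq> 0" using that(2) by (auto simp: h_def split: if_splits)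
      then have "c k \<omega> \<in> K" using K(3) by blast
      moreover have "cball (c k \<omega>) (rad lam \<alpha> k) \<subseteq> cball (c k \<omega>) r"
        using k0[of k] k m' by (intro subset_cball) auto
      ultimately have "cball (c k \<omega>) (rad lam \<alpha> k) \<subseteq> V" using r by blast
      moreover have "cball (c k \<omega>) (rad lam \<alpha> k) \<subseteq> tail_union m \<omega>"
        using cball_rad_subset[of "c k \<omega>" lam \<alpha> k] k m' unfolding tail_union_def by force
      ultimately show ?thesis by blast
    qed
    then obtain N' where "N' \<in> carried (V \<inter> tail_union m \<omega>)" "energy N' \<le> ennreal q"
      using good_block_imp_carried[OF _ h0 good q(1), of "V \<inter> tail_union m \<omega>"] by auto
    then have "min_energy (V \<inter> tail_union m \<omega>) \<le> ennreal q" using min_energy_le order_trans by blast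
    then show ?case using y(2) q(2) by simp
  qed
qed

text \<open>The exceptional null set depends on the bound \<open>b\<close>, so bounds are taken
  along a sequence decreasing to the minimum, which costs countably many null sets.\<close>

lemma AE_min_energy_tail_union:
  fixes f :: "real \<Rightarrow> real"
  assumes F: "F = density lborel (\<lambda>x. ennreal (f x))" and f_meas: "f \<in> borel_measurable borel"
    and f: "\<And>x. f x \<ge> 0" "AE x in lborel. x \<in> {0..1} \<longrightarrow> f x > 0"
    and V: "open V" "V \<subseteq> {0<..<1}"
  shows "AE \<omega> in P. min_energy (V \<inter> tail_union m \<omega>) \<le> min_energy V"
proof (cases "min_energy V = \<infinity>")
  case False
  define s where "s i = min_energy V + ennreal (1 / (real i + 1))" for i :: nat
  have "(\<lambda>i. ennreal (1 / (real i + 1))) \<longlonglongrightarrow> ennreal 0" by (rule tendsto_ennrealI) real_asymp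
  then have "s \<longlonglongrightarrow> min_energy V + 0" unfolding s_def by (intro tendsto_add tendsto_const) simp
  then have lim: "s \<longlonglongrightarrow> min_energy V" by simp
  have "min_energy V < s i" for i
    unfolding s_def using False
    by (cases "min_energy V") (auto simp: ennreal_less_iff simp flip: ennreal_plus)
  then have "AE \<omega> in P. \<forall>i. min_energy (V \<inter> tail_union m \<omega>) \<le> s i"
    unfolding AE_all_countable using AE_min_energy_tail_union_le[OF F f_meas f V] by blast
  then show ?thesis
    by eventually_elim (rule LIMSEQ_le_const[OF lim], blast)
qed simp

lemma AE_min_energy_limsup_set:
  fixes f :: "real \<Rightarrow> real"
  assumes F: "F = density lborel (\<lambda>x. ennreal (f x))" and f_meas: "f \<in> borel_measurable borel"
    and f: "\<And>x. f x \<ge> 0" "AE x in lborel. x \<in> {0..1} \<longrightarrow> f x > 0"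
  shows "AE \<omega> in P. min_energy ({0..1} \<inter> limsup_set lam \<alpha> (\<lambda>k. c k \<omega>)) = min_energy {0..1}"
proof -
  obtain \<B> :: "real set set" where \<B>: "countable \<B>" "topological_basis \<B>" using ex_countable_basis by blast
  \<comment> \<open>Finite unions of basic open sets: a countable family, so one null set serves
    them all, yet rich enough to fit between any compact set and any open set around it.\<close>
  define \<V> where "\<V> = {V \<in> Union ` {A. finite A \<and> A \<subseteq> \<B>}. V \<subseteq> {0<..<1}}"
  have cV: "countable \<V>"
    unfolding \<V>_def using countable_image[OF countable_Collect_finite_subset[OF \<B>(1)], of Union]
    by (rule countable_subset[rotated]) auto
  have opV: "open V" if "V \<in> \<V>" for V
    using that topological_basis_open[OF \<B>(2)] by (auto simp: \<V>_def intro!: open_Union)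
  have base: "\<exists>V\<in>Union ` {A. finite A \<and> A \<subseteq> \<B>}. K \<subseteq> V \<and> V \<subseteq> W"
    if K: "compact K" and W: "open W" "K \<subseteq> W" for K W
  proof -
    obtain \<C> where C: "\<C> \<subseteq> \<B>" "\<Union>\<C> = W" using \<B>(2) W(1) by (auto simp: topological_basis_def)
    then obtain A where "A \<subseteq> \<C>" "finite A" "K \<subseteq> \<Union>A"
      using compactE[OF K, of \<C>] W(2) topological_basis_open[OF \<B>(2)] by (metis subsetD)
    then show ?thesis using C by (intro bexI[of _ "\<Union>A"]) auto
  qed
  have "AE \<omega> in P. \<forall>V\<in>\<V>. \<forall>m. min_energy (V \<inter> tail_union m \<omega>) \<le> min_energy V"
    unfolding AE_ball_countable[OF cV] AE_all_countable
    using AE_min_energy_tail_union[OF F f_meas f] opV by (auto simp: \<V>_def)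
  then show ?thesis
  proof eventually_elim
    case (elim \<omega>)
    \<comment> \<open>The shift by \<open>Suc\<close> reflects that the intersection in
      \<open>limsup_set\<close> starts at index 1.\<close>
    have S: "limsup_set lam \<alpha> (\<lambda>k. c k \<omega>) = (\<Inter>m. tail_union (Suc m) \<omega>)"
      unfolding limsup_set_def tail_union_def
      by (intro INF_eq) (force simp: Suc_le_eq gr0_conv_Suc)+
    have "min_energy ({0..1} \<inter> (\<Inter>m. tail_union (Suc m) \<omega>)) \<le> min_energy {0<..<1}"
    proof (rule min_energy_Inter_le[where \<V>="Union ` {A. finite A \<and> A \<subseteq> \<B>}"])
      show "open V" if "V \<in> Union ` {A. finite A \<and> A \<subseteq> \<B>}" for V
        using that topological_basis_open[OF \<B>(2)] by (auto intro!: open_Union)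
      show "min_energy (V \<inter> tail_union (Suc n) \<omega>) \<le> min_energy V"
        if "V \<in> Union ` {A. finite A \<and> A \<subseteq> \<B>}" "V \<subseteq> {0<..<1}" for V n
        using that elim by (auto simp: \<V>_def)
    qed (use base open_tail_union in auto)
    also have "\<dots> \<le> min_energy {0..1}" by (rule min_energy_open_unit_interval)
    finally have "min_energy ({0..1} \<inter> (\<Inter>m. tail_union (Suc m) \<omega>)) \<le> min_energy {0..1}" .
    then show ?case unfolding S by (rule antisym) (rule min_energy_antimono, simp)
  qed
qed

end

section \<open>Capacity of the limsup set\<close>

lemma limsup_set_subset:
  assumes "lam > 0" "\<alpha> > 0" and "\<And>k. k \<ge> 1 \<Longrightarrow> c k \<in> {0..1}"
  shows "limsup_set lam \<alpha> c \<subseteq> {0..1}"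
proof
  fix x assume x: "x \<in> limsup_set lam \<alpha> c"
  have ex: "\<exists>k\<ge>Suc m. \<bar>x - c k\<bar> < exp (- lam * real k powr \<alpha>) / 2" for m
  proof -
    have "Suc m \<in> {1..}" by simp
    then obtain k where "k \<ge> Suc m"
        "x \<in> {c k - exp (- lam * real k powr \<alpha>) / 2 <..< c k + exp (- lam * real k powr \<alpha>) / 2}"
      using x unfolding limsup_set_def INT_iff UN_iff by blast
    moreover from this(2) have "\<bar>x - c k\<bar> < exp (- lam * real k powr \<alpha>) / 2"
      unfolding greaterThanLessThan_iff abs_less_iff by linarith
    ultimately show ?thesis by blast
  qed
  have lim: "(\<lambda>k. exp (- lam * real k powr \<alpha>) / 2) \<longlonglongrightarrow> 0" using assms(1,2) by real_asymp
  show "x \<in> {0..1}"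
  proof (rule ccontr)
    assume nx: "x \<notin> {0..1}"
    \<comment> \<open>The distance of \<open>x\<close> from [0,1]. Late intervals have half-length
      below \<open>d\<close> and centres in [0,1], so they cannot contain \<open>x\<close>.\<close>
    define d where "d = max (- x) (x - 1)"
    have d: "d > 0" using nx by (auto simp: d_def)
    obtain m where m: "\<And>k. k \<ge> m \<Longrightarrow> exp (- lam * real k powr \<alpha>) / 2 < d"
      using order_tendstoD(2)[OF lim d] unfolding eventually_sequentially by blast
    obtain k where k: "k \<ge> Suc m" "\<bar>x - c k\<bar> < exp (- lam * real k powr \<alpha>) / 2" using ex by blast
    have "d \<le> \<bar>x - c k\<bar>" using assms(3)[of k] k(1) by (auto simp: d_def)
    then show False using m[of k] k by simp
  qed
qed

theorem theorem1p5:
  fixes P :: "'a measure" and c :: "nat \<Rightarrow> 'a \<Rightarrow> real"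
    and f :: "real \<Rightarrow> real" and lam \<alpha> :: real
  assumes "prob_space P"
    and "lam > 0" and "\<alpha> > 0"
    and indep: "prob_space.indep_vars P (\<lambda>_. borel) c {1..}"
    and distr: "\<And>k. k \<ge> 1 \<Longrightarrow> distributed P lborel (c k) (\<lambda>x. ennreal (f x))"
    and f_meas: "f \<in> borel_measurable borel"
    and f_nonneg: "\<And>x. f x \<ge> 0"
    and f_supp: "\<And>x. x \<notin> {0..1} \<Longrightarrow> f x = 0"
    and f_bdd: "\<exists>B. \<forall>x. f x \<le> B"
    and f_pos: "AE x in lborel. x \<in> {0..1} \<longrightarrow> f x > 0"
  shows "(\<alpha> \<le> 1 \<longrightarrow>
            (AE \<omega> in P. log_capacity (complex_of_real ` limsup_set lam \<alpha> (\<lambda>k. c k \<omega>))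
                           = log_capacity (complex_of_real ` {0..1}))
            \<and> log_capacity (complex_of_real ` {0..1}) > 0)
       \<and> (\<alpha> > 1 \<longrightarrow>
            (\<forall>\<omega>\<in>space P. log_capacity (complex_of_real ` limsup_set lam \<alpha> (\<lambda>k. c k \<omega>)) = 0))"
proof (intro conjI impI ballI)
  show "log_capacity (complex_of_real ` {0..1}) > 0"
    by (rule log_capacity_pos[OF subset_refl min_energy_unit_interval_finite])
next
  fix \<omega> assume "\<alpha> > 1"
  then show "log_capacity (complex_of_real ` limsup_set lam \<alpha> (\<lambda>k. c k \<omega>)) = 0"
    using assms(2) by (intro log_capacity_eq_0 energy_limsup_set)
next
  assume \<alpha>: "\<alpha> \<le> 1"
  interpret prob_space P by fact
  define F where "F = density lborel (\<lambda>x. ennreal (f x))"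
  \<comment> \<open>\<open>distributed\<close> uses the target \<open>lborel\<close>, which has the
    same sets as \<open>borel\<close>, so the image measures coincide.\<close>
  have law: "distr P borel (c k) = F" if "k \<ge> 1" for k
    using distributed_distr_eq_density[OF distr[OF that]] by (simp add: F_def cong: distr_cong)
  interpret iid_seq P c F lam \<alpha>
    by unfold_locales (use assms \<alpha> law in auto)
  \<comment> \<open>Since \<open>f\<close> vanishes off [0,1], almost surely all centres lie there;
    the limsup set then does too, and intersecting it with [0,1] changes nothing.\<close>
  have "AE \<omega> in P. \<forall>k\<in>{1..}. c k \<omega> \<in> {0..1}"
  proof (subst AE_ball_countable, simp, intro ballI)
    fix k :: nat assume "k \<in> {1..}"
    then have k: "k \<ge> 1" by simp
    have "AE x in F. x \<in> {0..1}"
      unfolding F_def using f_meas f_supp by (subst AE_density) (auto intro!: AE_I2, force+)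
    then show "AE \<omega> in P. c k \<omega> \<in> {0..1}"
      unfolding law[OF k, symmetric] using c_measurable[OF k] by (subst (asm) AE_distr_iff) auto
  qed
  moreover have "AE \<omega> in P. min_energy ({0..1} \<inter> limsup_set lam \<alpha> (\<lambda>k. c k \<omega>)) = min_energy {0..1}"
    using F_def f_meas f_nonneg f_pos by (rule AE_min_energy_limsup_set)
  ultimately show "AE \<omega> in P. log_capacity (complex_of_real ` limsup_set lam \<alpha> (\<lambda>k. c k \<omega>))
                           = log_capacity (complex_of_real ` {0..1})"
  proof eventually_elim
    case (elim \<omega>)
    have "limsup_set lam \<alpha> (\<lambda>k. c k \<omega>) \<subseteq> {0..1}"
      using elim(1) by (intro limsup_set_subset assms) auto
    then show ?case
      using elim(2) by (intro log_capacity_unit_interval_cong) (auto simp: Int_absorb1)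
  qed
qed

end
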